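(* Let $m\ge 3$ be odd and let $G(m)$ be the dihedral Artin group. Then every finitely generated subgroup $A\le \mathrm{Aut}(G(m))$ is orbit decidable.
   Context: For $m\ge 2$ the dihedral Artin group is $G(m)=\langle a,b \mid {}_m(a,b)={}_m(b,a)\rangle$, where ${}_m(a,b)$ is the alternating word $abab\cdots$ of length $m$. For a group $G$ with finite inverse-closed generating set $X$ and a subgroup $A\le\mathrm{Aut}(G)$ (given by a finite generating set of automorphisms), the orbit decidability problem for $A$ takes as input two words $u,v\in X^*$ and asks to decide whether there exists $\phi\in A$ such that $v$ is conjugate to $\phi(u)$ in $G$. $A$ is orbit decidable if this problem is algorithmically solvable. *)

theory Defs
  imports "HOL-Algebra.Bij" "HOL-Algebra.Generated_Groups" "HOL-Library.Nat_Bijection"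
begin

section \<open>Group presentations\<close>

text \<open>In a word over \<open>'g\<close> and formal inverses, the letter \<open>(x, True)\<close> stands for the generator
  \<open>x\<close> and \<open>(x, False)\<close> for its inverse. A defining relation \<open>r = s\<close> is a pair \<open>(r, s)\<close>.\<close>

type_synonym 'g gword = "('g \<times> bool) list"

inductive pres_eq :: "('g gword \<times> 'g gword) set \<Rightarrow> 'g gword \<Rightarrow> 'g gword \<Rightarrow> bool"
  for R :: "('g gword \<times> 'g gword) set" where
  refl: "pres_eq R u u"
| sym: "pres_eq R u v \<Longrightarrow> pres_eq R v u"
| trans: "pres_eq R u v \<Longrightarrow> pres_eq R v w \<Longrightarrow> pres_eq R u w"
| cancel: "pres_eq R (u @ [(x, e), (x, \<not> e)] @ v) (u @ v)"
| rel: "(r, s) \<in> R \<Longrightarrow> pres_eq R (u @ r @ v) (u @ s @ v)"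

definition pres_class :: "('g gword \<times> 'g gword) set \<Rightarrow> 'g gword \<Rightarrow> 'g gword set" where
  "pres_class R u = {w. pres_eq R u w}"

text \<open>All elements of the type \<open>'g\<close> are taken as generators.\<close>

definition presented_group :: "('g gword \<times> 'g gword) set \<Rightarrow> 'g gword set monoid" where
  "presented_group R =
     \<lparr>carrier = range (pres_class R),
      monoid.mult = \<lambda>C D. {w. \<exists>u\<in>C. \<exists>v\<in>D. pres_eq R (u @ v) w},
      one = pres_class R []\<rparr>"

section \<open>Dihedral Artin groups\<close>

datatype dgen = GenA | GenB

fun alternating :: "nat \<Rightarrow> 'a \<Rightarrow> 'a \<Rightarrow> 'a list" where
  "alternating 0 x y = []"
| "alternating (Suc n) x y = x # alternating n y x"

definition dihedral_artin :: "nat \<Rightarrow> dgen gword set monoid" where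
  "dihedral_artin m =
     presented_group {(alternating m (GenA, True) (GenB, True),
                       alternating m (GenB, True) (GenA, True))}"

section \<open>Algorithms\<close>

text \<open>Programs for the partial recursive functions \<open>\<nat>\<^sup>n \<rightharpoonup> \<nat>\<close>, and their input-output relation.\<close>

datatype recf = Zero | Succ | Proj nat | Comp recf "recf list" | PrimRec recf recf | Mu recf

inductive evaluates :: "recf \<Rightarrow> nat list \<Rightarrow> nat \<Rightarrow> bool" where
  zero: "evaluates Zero xs 0"
| succ: "evaluates Succ [x] (Suc x)"
| proj: "i < length xs \<Longrightarrow> evaluates (Proj i) xs (xs ! i)"
| comp: "length ys = length gs \<Longrightarrow> (\<forall>i<length gs. evaluates (gs ! i) xs (ys ! i)) \<Longrightarrow>
    evaluates f ys z \<Longrightarrow> evaluates (Comp f gs) xs z"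
| primrec_0: "evaluates f xs y \<Longrightarrow> evaluates (PrimRec f g) (0 # xs) y"
| primrec_Suc: "evaluates (PrimRec f g) (n # xs) y \<Longrightarrow> evaluates g (n # y # xs) z \<Longrightarrow>
    evaluates (PrimRec f g) (Suc n # xs) z"
| mu: "evaluates f (n # xs) 0 \<Longrightarrow> (\<forall>k<n. \<exists>y. evaluates f (k # xs) (Suc y)) \<Longrightarrow>
    evaluates (Mu f) xs n"

inductive_cases evaluates_elims:
  "evaluates Zero xs y" "evaluates Succ xs y" "evaluates (Proj i) xs y"
  "evaluates (Comp f gs) xs y" "evaluates (PrimRec f g) (0 # xs) y"
  "evaluates (PrimRec f g) (Suc n # xs) y" "evaluates (Mu f) xs y"

lemma evaluates_deterministic:
  assumes "evaluates p xs y" and "evaluates p xs z"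
  shows "y = z"
  using assms
proof (induction arbitrary: z rule: evaluates.induct)
  case (comp ys gs xs f w)
  from comp.prems obtain ys' where ys': "length ys' = length gs"
    "\<forall>i<length gs. evaluates (gs ! i) xs (ys' ! i)" "evaluates f ys' z"
    by (rule evaluates_elims) blast
  have "ys = ys'"
    using comp.hyps comp.IH ys' by (intro nth_equalityI) auto
  with comp.IH(2) ys'(3) show ?case by blast
next
  case (primrec_Suc f g n xs y w)
  from primrec_Suc.prems obtain y' where "evaluates (PrimRec f g) (n # xs) y'"
    and "evaluates g (n # y' # xs) z"
    by (rule evaluates_elims)
  with primrec_Suc.IH show ?case by blast
next
  case (mu f n xs)
  from mu.prems obtain z0: "evaluates f (z # xs) 0"
    and zk: "\<forall>k<z. \<exists>y. evaluates f (k # xs) (Suc y)"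
    by (rule evaluates_elims)
  have "\<not> n < z" using zk mu.IH(1) by fastforce
  moreover have "\<not> z < n" using z0 mu.IH by fastforce
  ultimately show ?case by simp
next
  case (primrec_0 f xs y g)
  from primrec_0.prems have "evaluates f xs z" by (rule evaluates_elims)
  then show ?case by (rule primrec_0.IH)
qed (blast elim: evaluates_elims)+

text \<open>A set \<open>L\<close> of pairs of words over a finite alphabet \<open>X\<close> is decidable if some program, given
  the codes of any two words over \<open>X\<close>, halts with the answer 1 or 0 according to membership in \<open>L\<close>.
  The letters are coded by an arbitrary numbering of \<open>X\<close>; as \<open>X\<close> is finite, the
  choice does not matter.\<close>

definition decidable_word_pairs :: "'a set \<Rightarrow> ('a list \<times> 'a list) set \<Rightarrow> bool" where
  "decidable_word_pairs X L \<longleftrightarrow>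
     (\<forall>c :: 'a \<Rightarrow> nat. inj_on c X \<longrightarrow>
       (\<exists>p. \<forall>u\<in>lists X. \<forall>v\<in>lists X.
          evaluates p [list_encode (map c u), list_encode (map c v)]
            (if (u, v) \<in> L then 1 else 0)))"

section \<open>Orbit decidability\<close>

definition inverse_closed_generating_set :: "('a, 'b) monoid_scheme \<Rightarrow> 'a set \<Rightarrow> bool" where
  "inverse_closed_generating_set G X \<longleftrightarrow>
     X \<subseteq> carrier G \<and> (\<forall>x\<in>X. inv\<^bsub>G\<^esub> x \<in> X) \<and> generate G X = carrier G"

definition finitely_generated_subgroup :: "'a set \<Rightarrow> ('a, 'b) monoid_scheme \<Rightarrow> bool" where
  "finitely_generated_subgroup H G \<longleftrightarrow>
     subgroup H G \<and> (\<exists>S. finite S \<and> S \<subseteq> carrier G \<and> H = generate G S)"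

definition word_value :: "('a, 'b) monoid_scheme \<Rightarrow> 'a list \<Rightarrow> 'a" where
  "word_value G w = foldr (\<otimes>\<^bsub>G\<^esub>) w \<one>\<^bsub>G\<^esub>"

definition conjugate_in :: "('a, 'b) monoid_scheme \<Rightarrow> 'a \<Rightarrow> 'a \<Rightarrow> bool" where
  "conjugate_in G x y \<longleftrightarrow> (\<exists>g\<in>carrier G. x = g \<otimes>\<^bsub>G\<^esub> y \<otimes>\<^bsub>G\<^esub> inv\<^bsub>G\<^esub> g)"

definition orbit_problem ::
    "('a, 'b) monoid_scheme \<Rightarrow> 'a set \<Rightarrow> ('a \<Rightarrow> 'a) set \<Rightarrow> ('a list \<times> 'a list) set" where
  "orbit_problem G X A =
     {(u, v). u \<in> lists X \<and> v \<in> lists X \<and>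
        (\<exists>\<phi>\<in>A. conjugate_in G (word_value G v) (\<phi> (word_value G u)))}"

definition orbit_decidable :: "('a, 'b) monoid_scheme \<Rightarrow> 'a set \<Rightarrow> ('a \<Rightarrow> 'a) set \<Rightarrow> bool" where
  "orbit_decidable G X A \<longleftrightarrow> decidable_word_pairs X (orbit_problem G X A)"

section \<open>The presented group is a group\<close>

lemma pres_eq_context: "pres_eq R u v \<Longrightarrow> pres_eq R (x @ u @ y) (x @ v @ y)"
proof (induction rule: pres_eq.induct)
  case (cancel u a e v)
  show ?case using pres_eq.cancel[of R "x @ u" a e "v @ y"] by simp
next
  case (rel r s u v)
  then show ?case using pres_eq.rel[of r s R "x @ u" "v @ y"] by simp
next
  case refl
  show ?case by (rule pres_eq.refl)
next
  case sym
  show ?case by (rule pres_eq.sym) fact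
next
  case trans
  show ?case by (rule pres_eq.trans) fact+
qed

lemma pres_eq_append:
  assumes "pres_eq R u u'" and "pres_eq R v v'"
  shows "pres_eq R (u @ v) (u' @ v')"
proof (rule pres_eq.trans)
  show "pres_eq R (u @ v) (u' @ v)" using pres_eq_context[OF assms(1), of "[]" v] by simp
  show "pres_eq R (u' @ v) (u' @ v')" using pres_eq_context[OF assms(2), of u' "[]"] by simp
qed

lemma pres_class_eq_iff: "pres_class R u = pres_class R v \<longleftrightarrow> pres_eq R u v"
proof
  assume "pres_class R u = pres_class R v"
  moreover have "v \<in> pres_class R v" by (simp add: pres_class_def pres_eq.refl)
  ultimately have "v \<in> pres_class R u" by blast
  then show "pres_eq R u v" by (simp add: pres_class_def)
next
  assume uv: "pres_eq R u v"
  show "pres_class R u = pres_class R v"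
    unfolding pres_class_def
    using pres_eq.trans[OF uv] pres_eq.trans[OF pres_eq.sym[OF uv]] by blast
qed

lemma pres_class_mult:
  "pres_class R u \<otimes>\<^bsub>presented_group R\<^esub> pres_class R v = pres_class R (u @ v)"
proof -
  have "(\<exists>u'. pres_eq R u u' \<and> (\<exists>v'. pres_eq R v v' \<and> pres_eq R (u' @ v') w)) \<longleftrightarrow>
      pres_eq R (u @ v) w" for w
    using pres_eq_append[of R u _ v] pres_eq.trans pres_eq.refl by metis
  then show ?thesis by (simp add: presented_group_def pres_class_def Bex_def)
qed

definition inv_word :: "'g gword \<Rightarrow> 'g gword" where
  "inv_word u = rev (map (\<lambda>(x, e). (x, \<not> e)) u)"

lemma pres_eq_inv_word: "pres_eq R (inv_word u @ u) []"
proof (induction u)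
  case Nil
  show ?case by (simp add: inv_word_def pres_eq.refl)
next
  case (Cons l u)
  obtain x e where l: "l = (x, e)" by (cases l)
  have "pres_eq R (inv_word u @ [(x, \<not> e), (x, \<not> \<not> e)] @ u) (inv_word u @ u)"
    by (rule pres_eq.cancel)
  from pres_eq.trans[OF this Cons.IH] show ?case by (simp add: l inv_word_def)
qed

lemma group_presented_group: "group (presented_group R)"
proof (rule groupI)
  fix C assume "C \<in> carrier (presented_group R)"
  then obtain u where C: "C = pres_class R u" by (auto simp: presented_group_def)
  have one: "\<one>\<^bsub>presented_group R\<^esub> = pres_class R []" by (simp add: presented_group_def)
  show "\<one>\<^bsub>presented_group R\<^esub> \<otimes>\<^bsub>presented_group R\<^esub> C = C"
    by (simp add: one C pres_class_mult)
  show "\<exists>D\<in>carrier (presented_group R). D \<otimes>\<^bsub>presented_group R\<^esub> C = \<one>\<^bsub>presented_group R\<^esub>"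
    by (rule bexI[of _ "pres_class R (inv_word u)"])
      (simp_all add: one C pres_class_mult pres_class_eq_iff pres_eq_inv_word,
       simp add: presented_group_def)
next
  fix C D assume "C \<in> carrier (presented_group R)" "D \<in> carrier (presented_group R)"
  then obtain u v where "C = pres_class R u" "D = pres_class R v"
    by (auto simp: presented_group_def)
  then have "C \<otimes>\<^bsub>presented_group R\<^esub> D = pres_class R (u @ v)" by (simp add: pres_class_mult)
  then show "C \<otimes>\<^bsub>presented_group R\<^esub> D \<in> carrier (presented_group R)"
    by (simp add: presented_group_def)
next
  fix C D E assume "C \<in> carrier (presented_group R)" "D \<in> carrier (presented_group R)"
    "E \<in> carrier (presented_group R)"
  then obtain u v w where "C = pres_class R u" "D = pres_class R v" "E = pres_class R w"
    by (auto simp: presented_group_def)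
  then show "C \<otimes>\<^bsub>presented_group R\<^esub> D \<otimes>\<^bsub>presented_group R\<^esub> E =
      C \<otimes>\<^bsub>presented_group R\<^esub> (D \<otimes>\<^bsub>presented_group R\<^esub> E)"
    by (simp add: pres_class_mult)
qed (simp add: presented_group_def)

end

theory Submission
  imports Defs
begin

text \<open>
  Write \<open>m = 2 * k + 1\<close> and, in \<open>G(m)\<close>, put \<open>y = a b\<close> and \<open>x = y\<^sup>k a\<close>. The defining relation says
  \<open>x = b y\<^sup>k\<close> as well, so \<open>x\<^sup>2 = y\<^sup>k (a b) y\<^sup>k = y\<^sup>m\<close>. This element \<open>z\<close> is a power of \<open>x\<close> and of
  \<open>y\<close>, which generate the group, and is therefore central. Modulo \<open>z\<close> the group becomes the free
  product of \<open>\<langle>x\<rangle>\<close> of order 2 and \<open>\<langle>y\<rangle>\<close> of order \<open>m\<close>, whose elements are the reduced words. The exponent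
  sum of \<open>z\<close> is \<open>2 * m\<close>, which is not 0; hence an element \<open>g\<close> is determined by its reduced word \<open>N g\<close> and
  its exponent sum \<open>E g\<close> (lemma \<open>eq_if_N_E_eq\<close>). Both are computable, and everything is decided in
  terms of them.

  Conjugacy. Since \<open>z\<close> is central and \<open>E\<close> is invariant under conjugation, \<open>g\<close> and \<open>h\<close> are conjugate iff
  \<open>E g = E h\<close> and \<open>N g\<close>, \<open>N h\<close> are conjugate in the free product (\<open>conjugate_iff\<close>). The latter is
  expressed by a dynamical system on reduced words: \<open>rot\<close> moves the first letter to the end and
  reduces. Two words are conjugate iff their forward orbits under \<open>rot\<close> meet (\<open>meets_conj\<close>,
  \<open>meets_imp_conj\<close>). A word gets shorter under \<open>rot\<close> until it is cyclically reduced, and from then on it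
  is permuted cyclically; so a bounded search tells whether two orbits meet (\<open>meets_bounded\<close>).

  Automorphisms. An automorphism \<open>\<phi>\<close> preserves the centre \<open>\<langle>z\<rangle>\<close>, so \<open>\<phi> z = z\<^sup>n\<close> with \<open>n = 1\<close> or \<open>n = -1\<close>.
  The images of \<open>x\<close> and \<open>y\<close> have finite order modulo the centre, hence are conjugate to single letters
  there, and their exponent sums leave only \<open>x\<^sup>n\<close> and \<open>y\<^sup>n\<close> (\<open>phi_generators\<close>). The two conjugating elements
  can be taken equal, as otherwise \<open>\<phi>\<close> would not be surjective (\<open>normalised_trivial\<close>). So up to
  conjugacy \<open>\<phi>\<close> either fixes every element or inverts both \<open>x\<close> and \<open>y\<close> (\<open>automorphism_cases\<close>).

  Decision. The orbit of \<open>u\<close> under \<open>A\<close>, up to conjugacy, is therefore \<open>u\<close> alone or \<open>u\<close> together with its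
  image under the inversion of \<open>x\<close> and \<open>y\<close>, depending on whether \<open>A\<close> contains an automorphism of the
  second kind (\<open>orbit_iff\<close>). That is one truth value for each \<open>A\<close>, and it is built into the program,
  like the finite tables of the values of \<open>N\<close> and \<open>E\<close> on the letters of \<open>X\<close>.
\<close>

section \<open>Total computable functions\<close>

text \<open>The \<open>n\<close> arguments are kept in one list, so that one set of closure rules serves all
  arities; only the values of \<open>f\<close> on lists of length \<open>n\<close> count.\<close>

definition computable :: "nat \<Rightarrow> (nat list \<Rightarrow> nat) \<Rightarrow> bool" where
  "computable n f \<longleftrightarrow> (\<exists>p. \<forall>xs. length xs = n \<longrightarrow> evaluates p xs (f xs))"

lemma computable_cong:
  assumes "computable n f" and "\<And>xs. length xs = n \<Longrightarrow> f xs = g xs"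
  shows "computable n g"
  using assms by (auto simp: computable_def)

lemma computable_proj: "i < n \<Longrightarrow> computable n (\<lambda>xs. xs ! i)"
  unfolding computable_def by (auto intro!: exI[of _ "Proj i"] evaluates.proj)

lemma computable_comp:
  assumes "computable k f" and "length gs = k" and "\<And>g. g \<in> set gs \<Longrightarrow> computable n g"
  shows "computable n (\<lambda>xs. f (map (\<lambda>g. g xs) gs))"
proof -
  obtain p where p: "\<And>xs. length xs = k \<Longrightarrow> evaluates p xs (f xs)"
    using assms(1) by (auto simp: computable_def)
  obtain q where q: "\<And>g xs. g \<in> set gs \<Longrightarrow> length xs = n \<Longrightarrow> evaluates (q g) xs (g xs)"
    using assms(3) unfolding computable_def by metis
  have "evaluates (Comp p (map q gs)) xs (f (map (\<lambda>g. g xs) gs))" if "length xs = n" for xs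
    using that assms(2) by (intro evaluates.comp[where ys = "map (\<lambda>g. g xs) gs"] p) (auto intro: q)
  then show ?thesis by (auto simp: computable_def)
qed

lemma computable_Suc: "computable n f \<Longrightarrow> computable n (\<lambda>xs. Suc (f xs))"
proof -
  have "computable 1 (\<lambda>xs. Suc (xs ! 0))"
    unfolding computable_def by (auto intro!: exI[of _ Succ] simp: length_Suc_conv evaluates.succ)
  then show "computable n f \<Longrightarrow> ?thesis"
    using computable_comp[of 1 "\<lambda>xs. Suc (xs ! 0)" "[f]" n] by simp
qed

lemma computable_const: "computable n (\<lambda>_. c)"
proof (induction c)
  case 0
  show ?case unfolding computable_def by (blast intro: evaluates.zero)
qed (rule computable_Suc)

text \<open>The step function of a recursion receives the counter and the previous value in front of the
  parameters; this rule lets it ignore them.\<close>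

lemma computable_weaken: "computable n f \<Longrightarrow> computable (Suc (Suc n)) (\<lambda>ys. f (drop 2 ys))"
proof -
  assume f: "computable n f"
  have "computable (Suc (Suc n)) (\<lambda>ys. f (map (\<lambda>g. g ys) (map (\<lambda>i ys. ys ! (i + 2)) [0..<n])))"
    by (rule computable_comp[OF f]) (auto intro!: computable_proj)
  moreover have "map (\<lambda>g. g ys) (map (\<lambda>i ys. ys ! (i + 2)) [0..<n]) = drop 2 ys"
    if "length ys = Suc (Suc n)" for ys :: "nat list"
    using that by (intro nth_equalityI) (auto simp: add.commute)
  ultimately show ?thesis by (elim computable_cong) simp
qed

lemma computable_rec_nat:
  assumes "computable n N" and "computable n f"
    and "computable (Suc (Suc n)) (\<lambda>ys. g (ys ! 0) (ys ! 1) (drop 2 ys))"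
  shows "computable n (\<lambda>xs. rec_nat (f xs) (\<lambda>i y. g i y xs) (N xs))"
proof -
  obtain pf where pf: "\<And>xs. length xs = n \<Longrightarrow> evaluates pf xs (f xs)"
    using assms(2) by (auto simp: computable_def)
  obtain pg where pg: "\<And>ys. length ys = Suc (Suc n) \<Longrightarrow>
      evaluates pg ys (g (ys ! 0) (ys ! 1) (drop 2 ys))"
    using assms(3) by (auto simp: computable_def)
  have ev: "evaluates (PrimRec pf pg) (j # xs) (rec_nat (f xs) (\<lambda>i y. g i y xs) j)"
    if "length xs = n" for j xs
  proof (induction j)
    case 0
    show ?case using that by (auto intro: evaluates.primrec_0 pf)
  next
    case (Suc j)
    then show ?case
      using that pg[of "j # rec_nat (f xs) (\<lambda>i y. g i y xs) j # xs"]
      by (auto intro: evaluates.primrec_Suc)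
  qed
  have "computable (Suc n) (\<lambda>ys. rec_nat (f (tl ys)) (\<lambda>i y. g i y (tl ys)) (hd ys))"
    unfolding computable_def
  proof (intro exI allI impI)
    fix ys :: "nat list" assume "length ys = Suc n"
    then show "evaluates (PrimRec pf pg) ys (rec_nat (f (tl ys)) (\<lambda>i y. g i y (tl ys)) (hd ys))"
      using ev[of "tl ys" "hd ys"] by (cases ys) auto
  qed
  then have "computable n (\<lambda>xs. (\<lambda>ys. rec_nat (f (tl ys)) (\<lambda>i y. g i y (tl ys)) (hd ys))
      (map (\<lambda>h. h xs) (N # map (\<lambda>i xs. xs ! i) [0..<n])))"
    by (rule computable_comp) (use assms(1) in \<open>auto intro: computable_proj\<close>)
  then show ?thesis
  proof (rule computable_cong)
    fix xs :: "nat list" assume "length xs = n"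
    then have "map ((!) xs) [0..<n] = xs" by (metis map_nth)
    then show "(\<lambda>ys. rec_nat (f (tl ys)) (\<lambda>i y. g i y (tl ys)) (hd ys))
        (map (\<lambda>h. h xs) (N # map (\<lambda>i xs. xs ! i) [0..<n])) =
      rec_nat (f xs) (\<lambda>i y. g i y xs) (N xs)"
      by (simp add: comp_def)
  qed
qed

text \<open>Unbounded search halts because a root exists for all arguments.\<close>

lemma computable_Least:
  assumes "computable (Suc n) (\<lambda>ys. f (hd ys) (tl ys))"
    and "\<And>xs. length xs = n \<Longrightarrow> \<exists>i. f i xs = 0"
  shows "computable n (\<lambda>xs. LEAST i. f i xs = 0)"
proof -
  obtain p where p: "\<And>ys. length ys = Suc n \<Longrightarrow> evaluates p ys (f (hd ys) (tl ys))"
    using assms(1) by (auto simp: computable_def)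
  have "evaluates (Mu p) xs (LEAST i. f i xs = 0)" if xs: "length xs = n" for xs
  proof (rule evaluates.mu)
    have "f (LEAST i. f i xs = 0) xs = 0" using assms(2)[OF xs] by (rule LeastI_ex)
    then show "evaluates p ((LEAST i. f i xs = 0) # xs) 0"
      using p[of "(LEAST i. f i xs = 0) # xs"] xs by simp
    show "\<forall>j<LEAST i. f i xs = 0. \<exists>y. evaluates p (j # xs) (Suc y)"
    proof (intro allI impI)
      fix j assume "j < (LEAST i. f i xs = 0)"
      then obtain y where "f j xs = Suc y" using not_less_Least not0_implies_Suc by blast
      then show "\<exists>y. evaluates p (j # xs) (Suc y)" using p[of "j # xs"] xs by auto
    qed
  qed
  then show ?thesis by (auto simp: computable_def)
qed

text \<open>The state may be the code of a pair or of a list, so most recursions below are instances of this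
  rule.\<close>

lemma computable_funpow:
  assumes "computable n N" and "computable n s"
    and "computable 1 (\<lambda>ys. h (ys ! 0))"
  shows "computable n (\<lambda>xs. (h ^^ N xs) (s xs))"
proof -
  have "computable (Suc (Suc n)) (\<lambda>ys. h (ys ! 1))"
    using computable_comp[OF assms(3), of "[\<lambda>ys. ys ! 1]"] by (simp add: computable_proj)
  from computable_rec_nat[OF assms(1,2), of "\<lambda>i y xs. h y"] this
  have "computable n (\<lambda>xs. rec_nat (s xs) (\<lambda>i. h) (N xs))" by simp
  moreover have "rec_nat t (\<lambda>i. h) j = (h ^^ j) t" for t j by (induction j) auto
  ultimately show ?thesis by simp
qed

text \<open>Tests have a constant of their own: a characteristic function that is written as a conditional
  would match the rule for conditionals as well as the rules for tests.\<close>

definition computable_pred :: "nat \<Rightarrow> (nat list \<Rightarrow> bool) \<Rightarrow> bool" where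
  "computable_pred n P \<longleftrightarrow> computable n (\<lambda>xs. if P xs then 1 else 0)"

subsection \<open>Arithmetic and tests\<close>

lemma computable_add:
  assumes "computable n f" and "computable n g"
  shows "computable n (\<lambda>xs. f xs + g xs)"
proof -
  have "(Suc ^^ i) j = j + i" for i j by (induction i) auto
  with computable_funpow[OF assms(2,1), of Suc] show ?thesis by (simp add: computable_Suc computable_proj add.commute)
qed

lemma computable_diff:
  assumes "computable n f" and "computable n g"
  shows "computable n (\<lambda>xs. f xs - g xs)"
proof -
  have *: "rec_nat 0 (\<lambda>i y. i) j = j - 1" for j by (cases j) auto
  have pred: "computable 1 (\<lambda>xs. xs ! 0 - 1)"
    using computable_rec_nat[of 1 "\<lambda>xs. xs ! 0" "\<lambda>_. 0" "\<lambda>i y xs. i"]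
    by (simp add: computable_proj computable_const *)
  have "((\<lambda>x. x - 1) ^^ i) j = j - i" for i j :: nat by (induction i) auto
  then show ?thesis
    using computable_funpow[OF assms(2,1), of "\<lambda>x. x - 1"] pred by simp
qed

lemma computable_if:
  assumes "computable_pred n (\<lambda>xs. P xs)" and "computable n f" and "computable n g"
  shows "computable n (\<lambda>xs. if P xs then f xs else g xs)"
proof -
  have "computable n (\<lambda>xs. rec_nat (g xs) (\<lambda>i y. f xs) (if P xs then 1 else 0))"
    using computable_rec_nat[OF assms(1)[unfolded computable_pred_def] assms(3), of "\<lambda>i y xs. f xs"]
      computable_weaken[OF assms(2)] by simp
  then show ?thesis by (rule computable_cong) simp
qed

lemma computable_pred_not:
  assumes "computable_pred n P"
  shows "computable_pred n (\<lambda>xs. \<not> P xs)"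
  using computable_if[OF assms computable_const[of n 0] computable_const[of n 1]]
  unfolding computable_pred_def by (rule computable_cong) simp

lemma computable_pred_conj:
  assumes "computable_pred n P" and "computable_pred n Q"
  shows "computable_pred n (\<lambda>xs. P xs \<and> Q xs)"
  using computable_if[OF assms(1) assms(2)[unfolded computable_pred_def] computable_const[of n 0]]
  unfolding computable_pred_def by (rule computable_cong) simp

lemma computable_pred_disj:
  assumes "computable_pred n P" and "computable_pred n Q"
  shows "computable_pred n (\<lambda>xs. P xs \<or> Q xs)"
  using computable_if[OF assms(1) computable_const[of n 1] assms(2)[unfolded computable_pred_def]]
  unfolding computable_pred_def by (rule computable_cong) simp

lemma computable_pred_const: "computable_pred n (\<lambda>_. b)"
  by (simp add: computable_pred_def computable_const)

lemma computable_pred_eq: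
  assumes "computable n f" and "computable n g"
  shows "computable_pred n (\<lambda>xs. f xs = g xs)"
  \<comment> \<open>two numbers are equal iff both truncated differences are 0\<close>
  using computable_diff[OF computable_const[of n 1]
      computable_add[OF computable_diff[OF assms] computable_diff[OF assms(2,1)]]]
  unfolding computable_pred_def by (rule computable_cong) auto

lemma computable_pred_bex_less:
  assumes "computable n N" and "computable_pred (Suc (Suc n)) (\<lambda>ys. P (ys ! 0) (drop 2 ys))"
  shows "computable_pred n (\<lambda>xs. \<exists>i<N xs. P i xs)"
proof -
  have *: "rec_nat 0 (\<lambda>i y. if P i xs then 1 else y) j = (if \<exists>i<j. P i xs then 1 else 0 :: nat)"
    for xs j by (induction j) (auto simp: less_Suc_eq)
  have "computable n (\<lambda>xs. rec_nat 0 (\<lambda>i y. if P i xs then 1 else y) (N xs))"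
    by (rule computable_rec_nat[OF assms(1) computable_const])
      (rule computable_if[OF assms(2) computable_const computable_proj], simp)
  then show ?thesis by (simp only: * computable_pred_def)
qed

lemma computable_mod:
  assumes "computable n f"
  shows "computable n (\<lambda>xs. f xs mod m)"
proof -
  have *: "((\<lambda>y. if Suc y = m then 0 else Suc y) ^^ j) 0 = j mod m" for j
    by (induction j) (auto simp: mod_Suc)
  show ?thesis
    using computable_funpow[OF assms computable_const[of n 0], of "\<lambda>y. if Suc y = m then 0 else Suc y"]
    unfolding * by (simp add: computable_if computable_pred_eq computable_Suc computable_proj computable_const)
qed

text \<open>Such a function is a finite cascade of case distinctions. The values may come from data that no
  program computes.\<close>

lemma computable_finite_table:
  assumes "finite {i. t i \<noteq> 0}" and "computable n f"
  shows "computable n (\<lambda>xs. t (f xs))"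
  using assms(1)
proof (induction "{i. t i \<noteq> 0}" arbitrary: t rule: finite_induct)
  case empty
  then have "t = (\<lambda>_. 0)" by auto
  then show ?case by (simp add: computable_const)
next
  case (insert a S)
  have "S = {i. (t(a := 0)) i \<noteq> 0}" using insert.hyps by auto
  from insert.hyps(3)[OF this]
  have "computable n (\<lambda>xs. if f xs = a then t a else (t(a := 0)) (f xs))"
    by (intro computable_if computable_pred_eq computable_const assms(2))
  then show ?case by (rule computable_cong) auto
qed

subsection \<open>Pairs and lists\<close>

lemma computable_triangle:
  assumes "computable n f"
  shows "computable n (\<lambda>xs. triangle (f xs))"
proof -
  have "rec_nat 0 (\<lambda>i y. y + Suc i) j = triangle j" for j by (induction j) auto
  then show ?thesis
    using computable_rec_nat[OF assms computable_const[of n 0], of "\<lambda>i y xs. y + Suc i"]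
    by (simp add: computable_add computable_Suc computable_proj)
qed

lemma computable_prod_encode:
  assumes "computable n f" and "computable n g"
  shows "computable n (\<lambda>xs. prod_encode (f xs, g xs))"
  unfolding prod_encode_def prod.case
  by (intro computable_add computable_triangle assms)

lemma triangle_mono: "i \<le> j \<Longrightarrow> triangle i \<le> triangle j"
  by (induction j) (auto simp: le_Suc_eq)

text \<open>Minimization finds the sum of the two components of a pair; the components then follow by
  subtraction.\<close>

lemma prod_encode_sum_Least:
  "(LEAST s. Suc (prod_encode (i, j)) - triangle (Suc s) = 0) = i + j"
proof (rule Least_equality)
  show "Suc (prod_encode (i, j)) - triangle (Suc (i + j)) = 0" by (simp add: prod_encode_def)
  fix s assume s: "Suc (prod_encode (i, j)) - triangle (Suc s) = 0"
  show "i + j \<le> s"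
  proof (rule ccontr)
    assume "\<not> i + j \<le> s"
    then have "triangle (Suc s) \<le> triangle (i + j)" by (intro triangle_mono) simp
    with s show False by (simp add: prod_encode_def)
  qed
qed

lemma computable_prod_decode:
  assumes "computable n f"
  shows "computable n (\<lambda>xs. fst (prod_decode (f xs)))"
    and "computable n (\<lambda>xs. snd (prod_decode (f xs)))"
proof -
  define S where "S c = (LEAST s. Suc c - triangle (Suc s) = 0)" for c
  have S: "S (prod_encode (i, j)) = i + j" for i j unfolding S_def by (rule prod_encode_sum_Least)
  have "computable 1 (\<lambda>xs. LEAST s. Suc (xs ! 0) - triangle (Suc s) = 0)"
  proof (rule computable_Least)
    have "computable (Suc 1) (\<lambda>ys. Suc (ys ! 1) - triangle (Suc (ys ! 0)))"
      by (intro computable_diff computable_triangle computable_Suc computable_proj) auto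
    then show "computable (Suc 1) (\<lambda>ys. Suc (tl ys ! 0) - triangle (Suc (hd ys)))"
      by (rule computable_cong) (auto simp: length_Suc_conv)
    fix xs :: "nat list"
    show "\<exists>i. Suc (xs ! 0) - triangle (Suc i) = 0"
      by (rule exI[of _ "Suc (xs ! 0)"]) (simp add: triangle_def)
  qed
  then have CS: "computable n (\<lambda>xs. S (f xs))"
    unfolding S_def[symmetric] using computable_comp[of 1 "\<lambda>xs. S (xs ! 0)" "[f]" n] assms by simp
  have dec: "fst (prod_decode c) = c - triangle (S c)"
    "snd (prod_decode c) = S c - (c - triangle (S c))" for c
  proof -
    obtain i j where c: "c = prod_encode (i, j)" by (metis prod_decode_inverse surj_pair)
    have "c - triangle (S c) = i" unfolding c S by (simp add: prod_encode_def)
    then show "fst (prod_decode c) = c - triangle (S c)"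
      and "snd (prod_decode c) = S c - (c - triangle (S c))"
      using S[of i j] by (simp_all add: c)
  qed
  show "computable n (\<lambda>xs. fst (prod_decode (f xs)))"
    and "computable n (\<lambda>xs. snd (prod_decode (f xs)))"
    unfolding dec by (intro computable_diff computable_triangle assms CS)+
qed

definition computable_list :: "nat \<Rightarrow> (nat list \<Rightarrow> nat list) \<Rightarrow> bool" where
  "computable_list n F \<longleftrightarrow> computable n (\<lambda>xs. list_encode (F xs))"

lemma computable_list_const: "computable_list n (\<lambda>_. c)"
  by (simp add: computable_list_def computable_const)

lemma computable_list_Cons:
  assumes "computable n f" and "computable_list n F"
  shows "computable_list n (\<lambda>xs. f xs # F xs)"
  using assms unfolding computable_list_def list_encode.simps
  by (intro computable_Suc computable_prod_encode)

lemma computable_list_if: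
  assumes "computable_pred n (\<lambda>xs. P xs)"
    and "computable_list n F" and "computable_list n F'"
  shows "computable_list n (\<lambda>xs. if P xs then F xs else F' xs)"
  using computable_if[OF assms[unfolded computable_list_def]]
  unfolding computable_list_def by (rule computable_cong) simp

lemma computable_pred_list_eq:
  assumes "computable_list n F" and "computable_list n F'"
  shows "computable_pred n (\<lambda>xs. F xs = F' xs)"
  using computable_pred_eq[OF assms[unfolded computable_list_def]] by (simp add: list_encode_eq)

text \<open>The value 0 on the empty list makes \<open>head0\<close>, like \<open>tl\<close>, a plain projection of codes: the empty list
  has code 0, which decodes to the pair of 0 and 0.\<close>

definition head0 :: "nat list \<Rightarrow> nat" where
  "head0 w = (case w of [] \<Rightarrow> 0 | l # _ \<Rightarrow> l)"

lemma computable_head0_tl: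
  assumes "computable_list n F"
  shows "computable n (\<lambda>xs. head0 (F xs))" and "computable_list n (\<lambda>xs. tl (F xs))"
proof -
  have 0: "prod_decode 0 = (0, 0)" using prod_encode_inverse[of "(0, 0)"] by (simp add: prod_encode_def)
  have dec: "head0 w = fst (prod_decode (list_encode w - 1))"
    "list_encode (tl w) = snd (prod_decode (list_encode w - 1))" for w
    by (cases w; simp add: head0_def 0)+
  show "computable n (\<lambda>xs. head0 (F xs))" and "computable_list n (\<lambda>xs. tl (F xs))"
    using assms unfolding computable_list_def dec
    by (auto intro!: computable_prod_decode computable_diff computable_const simp del: One_nat_def)
qed

lemma length_le_list_encode: "length w \<le> list_encode w"
proof (induction w)
  case (Cons l w)
  then show ?case using le_prod_encode_2[of "list_encode w" l] by simp
qed simp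

text \<open>A fold runs through the pairs of remaining list and accumulator. The code of the list bounds
  its length, so it can serve as the number of rounds.\<close>

lemma computable_fold_aux:
  assumes "computable n (\<lambda>xs. list_encode (L xs))" and "computable n s"
    and "computable 2 (\<lambda>ys. g (ys ! 0) (ys ! 1))"
  shows "computable n (\<lambda>xs. fold g (L xs) (s xs))"
proof -
  define h where "h c = (let r = fst (prod_decode c); acc = snd (prod_decode c) in
    if r = 0 then c
    else prod_encode (snd (prod_decode (r - 1)), g (fst (prod_decode (r - 1))) acc))" for c
  have h0: "h (prod_encode (0, acc)) = prod_encode (0, acc)" for acc by (simp add: h_def)
  have hS: "h (prod_encode (list_encode (l # w), acc)) = prod_encode (list_encode w, g l acc)"
    for l w acc by (simp add: h_def)
  have h0N: "(h ^^ N) (prod_encode (0, acc)) = prod_encode (0, acc)" for N acc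
    by (induction N) (simp_all add: h0)
  have iter: "length w \<le> N \<Longrightarrow>
      (h ^^ N) (prod_encode (list_encode w, acc)) = prod_encode (0, fold g w acc)" for w N acc
  proof (induction w arbitrary: N acc)
    case Nil
    show ?case by (simp add: h0N)
  next
    case (Cons l w)
    then obtain N' where N': "N = Suc N'" "length w \<le> N'" by (cases N) auto
    show ?case unfolding N'(1) funpow_Suc_right comp_def hS using Cons.IH[OF N'(2)] by simp
  qed
  have g: "computable k (\<lambda>xs. g (f xs) (f' xs))" if "computable k f" "computable k f'" for k f f'
    using computable_comp[OF assms(3), of "[f, f']" k] that by auto
  have h: "computable 1 (\<lambda>ys. h (ys ! 0))"
    unfolding h_def Let_def
    by (intro computable_if computable_pred_eq computable_prod_decode computable_proj computable_const
        computable_prod_encode computable_diff g) auto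
  have "computable n (\<lambda>xs. snd (prod_decode
      ((h ^^ list_encode (L xs)) (prod_encode (list_encode (L xs), s xs)))))"
    by (intro computable_prod_decode computable_funpow computable_prod_encode assms h)
  then show ?thesis by (rule computable_cong) (simp add: iter length_le_list_encode)
qed

lemma computable_list_rev:
  assumes "computable_list n F"
  shows "computable_list n (\<lambda>xs. rev (F xs))"
proof -
  have *: "fold (\<lambda>l c. Suc (prod_encode (l, c))) w (list_encode acc) = list_encode (rev w @ acc)"
    for w acc
  proof (induction w arbitrary: acc)
    case (Cons l w)
    show ?case using Cons.IH[of "l # acc"] by simp
  qed simp
  have "computable n (\<lambda>xs. fold (\<lambda>l c. Suc (prod_encode (l, c))) (F xs) 0)"
    using assms unfolding computable_list_def
    by (intro computable_fold_aux computable_const computable_Suc computable_prod_encode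
        computable_proj) auto
  then show ?thesis using *[of _ "[]"] by (simp add: computable_list_def)
qed

lemma computable_foldr:
  assumes "computable_list n L" and "computable n s"
    and "computable 2 (\<lambda>ys. g (ys ! 0) (ys ! 1))"
  shows "computable n (\<lambda>xs. foldr g (L xs) (s xs))"
  using computable_fold_aux[OF computable_list_rev[OF assms(1), unfolded computable_list_def] assms(2,3)]
  by (simp add: foldr_conv_fold)

text \<open>The program works on codes while \<open>G\<close> works on lists; \<open>list_decode\<close> turns an accumulator of the
  program into an argument of \<open>G\<close>.\<close>

lemma computable_list_foldr:
  assumes "computable_list n L" and "computable_list n S"
    and "computable_list 2 (\<lambda>ys. G (ys ! 0) (list_decode (ys ! 1)))"
  shows "computable_list n (\<lambda>xs. foldr G (L xs) (S xs))"
proof -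
  have *: "foldr (\<lambda>l c. list_encode (G l (list_decode c))) w (list_encode s) = list_encode (foldr G w s)"
    for w s by (induction w) auto
  have "computable n (\<lambda>xs. foldr (\<lambda>l c. list_encode (G l (list_decode c))) (L xs) (list_encode (S xs)))"
    using assms by (intro computable_foldr) (auto simp: computable_list_def)
  then show ?thesis by (simp add: * computable_list_def)
qed

lemma computable_list_decode: "computable n f \<Longrightarrow> computable_list n (\<lambda>xs. list_decode (f xs))"
  by (simp add: computable_list_def)

lemma computable_list_append:
  assumes "computable_list n F" and "computable_list n F'"
  shows "computable_list n (\<lambda>xs. F xs @ F' xs)"
proof -
  have "computable_list n (\<lambda>xs. foldr (#) (F xs) (F' xs))"
    using assms by (intro computable_list_foldr computable_list_Cons computable_proj
        computable_list_decode) auto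
  moreover have "foldr (#) w w' = w @ w'" for w w' :: "nat list" by (induction w) auto
  ultimately show ?thesis by simp
qed

lemma computable_list_rotate1:
  assumes "computable_list n F"
  shows "computable_list n (\<lambda>xs. rotate1 (F xs))"
proof -
  have *: "rotate1 w = (if w = [] then [] else tl w @ [head0 w])" for w
    by (cases w) (auto simp: head0_def)
  show ?thesis unfolding *
    by (intro computable_list_if computable_pred_list_eq computable_list_const computable_list_append
        computable_list_Cons computable_head0_tl assms)
qed

lemma computable_list_funpow:
  assumes "computable n N" and "computable_list n F"
    and "computable_list 1 (\<lambda>ys. H (list_decode (ys ! 0)))"
  shows "computable_list n (\<lambda>xs. (H ^^ N xs) (F xs))"
proof -
  have *: "((\<lambda>c. list_encode (H (list_decode c))) ^^ i) (list_encode w) = list_encode ((H ^^ i) w)"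
    for i w by (induction i) auto
  have "computable n (\<lambda>xs. ((\<lambda>c. list_encode (H (list_decode c))) ^^ N xs) (list_encode (F xs)))"
    using assms by (intro computable_funpow) (auto simp: computable_list_def)
  then show ?thesis by (simp add: * computable_list_def)
qed

section \<open>Conjugation in groups\<close>

lemma (in group) commute_inv:
  assumes "x \<in> carrier G" "y \<in> carrier G" "x \<otimes> y = y \<otimes> x"
  shows "x \<otimes> inv y = inv y \<otimes> x"
proof -
  have "x \<otimes> inv y = inv y \<otimes> (y \<otimes> x) \<otimes> inv y" using assms(1,2) by (simp flip: m_assoc)
  also have "\<dots> = inv y \<otimes> (x \<otimes> y) \<otimes> inv y" using assms(3) by simp
  also have "\<dots> = inv y \<otimes> x" using assms(1,2) by (simp add: m_assoc)
  finally show ?thesis .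
qed

lemma (in group) inv_cancel_left:
  assumes "x \<in> carrier G" "y \<in> carrier G"
  shows "x \<otimes> (inv x \<otimes> y) = y" and "inv x \<otimes> (x \<otimes> y) = y"
  using assms by (simp_all flip: m_assoc)

lemma (in group) conj_absorb:
  assumes "t \<in> carrier G" "c \<in> carrier G" "x \<in> carrier G" "c \<otimes> x = x \<otimes> c"
  shows "(t \<otimes> c) \<otimes> x \<otimes> inv (t \<otimes> c) = t \<otimes> x \<otimes> inv t"
proof -
  have "(t \<otimes> c) \<otimes> x \<otimes> inv (t \<otimes> c) = t \<otimes> ((c \<otimes> x) \<otimes> (inv c \<otimes> inv t))"
    using assms(1-3) by (simp add: inv_mult_group m_assoc)
  then show ?thesis unfolding assms(4) using assms(1-3) by (simp add: m_assoc inv_cancel_left)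
qed

lemma (in group) conj_mult:
  assumes "t \<in> carrier G" "x \<in> carrier G" "y \<in> carrier G"
  shows "inv t \<otimes> (x \<otimes> y) \<otimes> t = (inv t \<otimes> x \<otimes> t) \<otimes> (inv t \<otimes> y \<otimes> t)"
  using assms by (simp add: m_assoc inv_cancel_left)

lemma (in group) conj_nat_pow:
  assumes "t \<in> carrier G" "x \<in> carrier G"
  shows "inv t \<otimes> (x [^] (n::nat)) \<otimes> t = (inv t \<otimes> x \<otimes> t) [^] n"
  by (induction n) (use assms in \<open>auto simp: conj_mult\<close>)

section \<open>The free product of two cyclic groups\<close>

text \<open>The free product of a group \<open>\<langle>x\<rangle>\<close> of order 2 and a group \<open>\<langle>y\<rangle>\<close> of order \<open>m\<close>. Its elements are written
  as lists of numbers below \<open>m\<close>: the letter 0 stands for \<open>x\<close> and a letter \<open>l \<noteq> 0\<close> for \<open>y\<^sup>l\<close>. In a reduced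
  word the two kinds of letters alternate.\<close>

locale free_product_cyclic =
  fixes m :: nat
  assumes m_ge_2: "m \<ge> 2"
begin

abbreviation alternate :: "nat list \<Rightarrow> bool" where
  "alternate \<equiv> successively (\<lambda>i j. (i = 0) \<noteq> (j = 0))"

abbreviation words :: "nat list set" where
  "words \<equiv> lists {..<m}"

definition reduced :: "nat list \<Rightarrow> bool" where
  "reduced w \<longleftrightarrow> w \<in> words \<and> alternate w"

text \<open>Multiplication of a reduced word by a letter from the left. Letters of the same kind are added
  modulo \<open>m\<close>; for two letters 0 the sum is 0 as well, so the same clause cancels \<open>x\<close> against \<open>x\<close>.\<close>

definition act :: "nat \<Rightarrow> nat list \<Rightarrow> nat list" where
  "act l w = (if w = [] \<or> (head0 w = 0) \<noteq> (l = 0) then l # w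
     else if (l + head0 w) mod m = 0 then tl w else (l + head0 w) mod m # tl w)"

text \<open>As in van der Waerden's proof of the normal form theorem, a word is reduced by letting it act on
  the empty word.\<close>

definition nf :: "nat list \<Rightarrow> nat list" where
  "nf w = foldr act w []"

definition neg :: "nat \<Rightarrow> nat" where
  "neg l = (m - l) mod m"

definition inv_of :: "nat list \<Rightarrow> nat list" where
  "inv_of w = rev (map neg w)"

lemma m_pos [simp]: "0 < m" using m_ge_2 by simp

lemma head0_simps [simp]: "head0 [] = 0" "head0 (l # w) = l"
  by (simp_all add: head0_def)

lemma reduced_simps [simp]: "reduced []" "reduced [l] \<longleftrightarrow> l < m"
  by (auto simp: reduced_def)

lemma reduced_Cons: "reduced (l # w) \<longleftrightarrow> l < m \<and> reduced w \<and> (w = [] \<or> (l = 0) \<noteq> (hd w = 0))"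
  by (auto simp: reduced_def successively_Cons)

lemma reduced_append: "reduced (u @ v) \<longleftrightarrow>
    reduced u \<and> reduced v \<and> (u = [] \<or> v = [] \<or> (last u = 0) \<noteq> (hd v = 0))"
  by (auto simp: reduced_def successively_append_iff)

lemma reduced_words: "reduced w \<Longrightarrow> w \<in> words" by (simp add: reduced_def)

lemma neg_less [simp]: "neg l < m" by (simp add: neg_def)

lemma neg_0 [simp]: "neg 0 = 0" by (simp add: neg_def)

lemma neg_eq_0 [simp]: "l < m \<Longrightarrow> neg l = 0 \<longleftrightarrow> l = 0"
  by (cases "l = 0") (auto simp: neg_def)

lemma neg_neg [simp]: "l < m \<Longrightarrow> neg (neg l) = l"
  by (cases "l = 0") (auto simp: neg_def)

lemma add_neg_mod [simp]: "l < m \<Longrightarrow> (l + neg l) mod m = 0" "l < m \<Longrightarrow> (neg l + l) mod m = 0"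
  by (simp_all add: neg_def mod_simps)

lemma act_Cons:
  "act l (t # w) = (if (t = 0) \<noteq> (l = 0) then l # t # w
     else if (l + t) mod m = 0 then w else (l + t) mod m # w)"
  by (auto simp: act_def)

lemma act_Nil [simp]: "act l [] = [l]" by (simp add: act_def)

lemma act_reduced_Cons: "reduced (l # w) \<Longrightarrow> act l w = l # w"
  by (cases w) (auto simp: act_Cons reduced_Cons)

lemma reduced_act: "reduced w \<Longrightarrow> l < m \<Longrightarrow> reduced (act l w)"
  by (cases w) (auto simp: act_Cons reduced_Cons)

lemma reduced_foldr_act: "u \<in> words \<Longrightarrow> reduced w \<Longrightarrow> reduced (foldr act u w)"
  by (induction u) (auto simp: reduced_act)

lemma reduced_nf: "w \<in> words \<Longrightarrow> reduced (nf w)"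
  by (simp add: nf_def reduced_foldr_act)

lemma nf_reduced: "reduced w \<Longrightarrow> nf w = w"
  by (induction w) (auto simp: nf_def act_reduced_Cons reduced_Cons)

text \<open>The letters of each kind act as the cyclic group that they belong to; hence words act through the
  free product.\<close>

lemma act_act:
  assumes "reduced w" "l < m" "t < m" "(l = 0) = (t = 0)"
  shows "act l (act t w) = (if (l + t) mod m = 0 then w else act ((l + t) mod m) w)"
proof (cases w)
  case Nil
  then show ?thesis using assms by (auto simp: act_Cons)
next
  case (Cons s r)
  show ?thesis
  proof (cases "(s = 0) = (l = 0)")
    case False
    then show ?thesis using assms Cons by (auto simp: act_Cons)
  next
    case True
    have r: "r = [] \<or> (head0 r = 0) \<noteq> (s = 0)" and s: "s < m"
      using assms(1) Cons by (cases r; auto simp: reduced_Cons)+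
    have r': "act i r = i # r" if "(i = 0) = (s = 0)" for i
      using r that by (auto simp: act_def)
    show ?thesis
    proof (cases "l = 0")
      case True
      then show ?thesis using assms Cons \<open>(s = 0) = (l = 0)\<close> r' by (auto simp: act_Cons)
    next
      case False
      have A: "(t + s) mod m = 0 \<Longrightarrow> ((l + t) mod m + s) mod m = l"
      proof -
        assume h: "(t + s) mod m = 0"
        have "((l + t) mod m + s) mod m = (l + (t + s) mod m) mod m"
          by (simp add: mod_simps add.assoc)
        also have "\<dots> = l" using h assms by simp
        finally show ?thesis .
      qed
      have B: "(l + (t + s) mod m) mod m = ((l + t) mod m + s) mod m"
        by (simp add: mod_simps add.assoc)
      have C: "(l + t) mod m = 0 \<Longrightarrow> ((l + t) mod m + s) mod m = s" using s by simp
      show ?thesis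
        using assms Cons True False r' A B C by (auto simp: act_Cons)
    qed
  qed
qed

lemma foldr_act_act:
  assumes "reduced s" "reduced w" "l < m"
  shows "foldr act (act l w) s = act l (foldr act w s)"
proof (cases w)
  case (Cons t r)
  then have "r \<in> words" "t < m" using assms(2) by (auto simp: reduced_def)
  then have "reduced (foldr act r s)" using assms(1) by (rule_tac reduced_foldr_act)
  then show ?thesis using assms \<open>t < m\<close> act_act[of "foldr act r s" l t] Cons
    by (auto simp: act_Cons)
qed simp

text \<open>A word and its normal form act alike. This makes equality of normal forms a congruence for
  concatenation (see \<open>nf_cong\<close>), so that reduced words form a group without any further check of
  associativity.\<close>

lemma foldr_act_nf: "w \<in> words \<Longrightarrow> reduced s \<Longrightarrow> foldr act (nf w) s = foldr act w s"
proof (induction w)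
  case (Cons l w)
  then show ?case using foldr_act_act[of s "nf w" l] reduced_nf[of w] by (simp add: nf_def)
qed (simp add: nf_def)

lemma nf_append: "nf (u @ v) = foldr act u (nf v)" by (simp add: nf_def)

lemma nf_append_nf [simp]:
  assumes "u \<in> words" "v \<in> words"
  shows "nf (nf u @ v) = nf (u @ v)" and "nf (u @ nf v) = nf (u @ v)"
  using assms by (simp_all add: nf_append foldr_act_nf reduced_nf nf_reduced)

lemma nf_words: "w \<in> words \<Longrightarrow> nf w \<in> words"
  using reduced_nf reduced_words by blast

lemma nf_nf: "w \<in> words \<Longrightarrow> nf (nf w) = nf w"
  using reduced_nf nf_reduced by blast

lemma nf_cong:
  assumes "nf u = nf v" and "p \<in> words" "u \<in> words" "v \<in> words" "s \<in> words"
  shows "nf (p @ u @ s) = nf (p @ v @ s)"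
proof -
  have "nf (u @ s) = nf (v @ s)" using assms nf_append_nf(1)[of u s] nf_append_nf(1)[of v s] by simp
  then show ?thesis by (simp add: nf_append[of p])
qed

lemma nf_cancel: "l < m \<Longrightarrow> nf [l, neg l] = []" "l < m \<Longrightarrow> nf [neg l, l] = []"
  by (auto simp: nf_def act_Cons)

lemma nf_cancel_middle:
  assumes "l < m" "p \<in> words" "s \<in> words"
  shows "nf (p @ l # neg l # s) = nf (p @ s)" and "nf (p @ neg l # l # s) = nf (p @ s)"
  using nf_cong[of "[l, neg l]" "[]" p s] nf_cong[of "[neg l, l]" "[]" p s] assms
  by (simp_all add: nf_cancel nf_def[of "[]"])

lemma inv_of_words [simp]: "inv_of w \<in> words" by (auto simp: inv_of_def)

lemma inv_of_simps [simp]: "inv_of [] = []" "inv_of (l # w) = inv_of w @ [neg l]"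
  "inv_of (u @ v) = inv_of v @ inv_of u"
  by (simp_all add: inv_of_def)

lemma inv_of_inv_of [simp]: "w \<in> words \<Longrightarrow> inv_of (inv_of w) = w"
  by (induction w) auto

lemma inv_of_eq_Nil [simp]: "inv_of w = [] \<longleftrightarrow> w = []" by (simp add: inv_of_def)

lemma reduced_inv_of: "reduced w \<Longrightarrow> reduced (inv_of w)"
proof (induction w)
  case (Cons l w)
  then have "w \<noteq> [] \<Longrightarrow> hd w < m" by (cases w) (auto simp: reduced_Cons)
  with Cons show ?case
    by (auto simp: reduced_append reduced_Cons) (auto simp: inv_of_def last_rev hd_map)
qed simp

lemma nf_inv_of_middle:
  assumes "w \<in> words" "p \<in> words" "s \<in> words"
  shows "nf (p @ w @ inv_of w @ s) = nf (p @ s)" and "nf (p @ inv_of w @ w @ s) = nf (p @ s)"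
proof -
  have *: "nf (p @ w @ inv_of w @ s) = nf (p @ s)" if "w \<in> words" for w
    using that assms(2,3)
  proof (induction w arbitrary: p s rule: list.induct)
    case (Cons l w)
    then show ?case using Cons.IH[of "p @ [l]" "neg l # s"] nf_cancel_middle[of l p s] by simp
  qed simp
  show "nf (p @ w @ inv_of w @ s) = nf (p @ s)" using * assms by blast
  show "nf (p @ inv_of w @ w @ s) = nf (p @ s)" using *[of "inv_of w"] assms by simp
qed

lemma nf_inv_of_nf:
  assumes "w \<in> words"
  shows "nf (inv_of (nf w)) = nf (inv_of w)"
proof -
  have "nf (inv_of (nf w)) = nf (inv_of (nf w) @ w @ inv_of w)"
    using nf_inv_of_middle(1)[of w "inv_of (nf w)" "[]"] assms by simp
  also have "\<dots> = nf (inv_of (nf w) @ nf w @ inv_of w)"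
    using assms by (intro nf_cong) (auto simp: nf_nf nf_words)
  also have "\<dots> = nf (inv_of w)"
    using nf_inv_of_middle(2)[of "nf w" "[]" "inv_of w"] assms nf_words by simp
  finally show ?thesis .
qed

section \<open>Conjugacy and rotation\<close>

text \<open>Moving the first letter \<open>t\<close> to the end is conjugation by \<open>t\<close> (see \<open>rot_eq_conj\<close>), so \<open>rot\<close> stays in
  the conjugacy class.\<close>

definition rot :: "nat list \<Rightarrow> nat list" where
  "rot w = nf (rotate1 w)"

text \<open>As \<open>rot\<close> is a function, this is an equivalence relation: two orbits that both meet a third one
  merge with it, and hence with each other.\<close>

definition meets :: "nat list \<Rightarrow> nat list \<Rightarrow> bool" where
  "meets u v \<longleftrightarrow> (\<exists>i j. (rot ^^ i) u = (rot ^^ j) v)"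

lemma meets_refl [simp]: "meets u u" unfolding meets_def by blast

lemma meets_sym: "meets u v \<Longrightarrow> meets v u" unfolding meets_def by metis

lemma meets_trans:
  assumes "meets u v" "meets v w"
  shows "meets u w"
proof -
  obtain i j where "(rot ^^ i) u = (rot ^^ j) v" using assms(1) by (auto simp: meets_def)
  moreover obtain k l where "(rot ^^ k) v = (rot ^^ l) w" using assms(2) by (auto simp: meets_def)
  moreover have "(rot ^^ k) ((rot ^^ j) v) = (rot ^^ j) ((rot ^^ k) v)"
    using fun_cong[OF funpow_add[of k j rot], of v] fun_cong[OF funpow_add[of j k rot], of v]
    by (simp add: add.commute)
  ultimately have "(rot ^^ (k + i)) u = (rot ^^ (j + l)) w" by (simp add: funpow_add)
  then show ?thesis by (auto simp: meets_def)
qed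

lemma meets_rot: "meets (rot u) u" "meets u (rot u)"
  unfolding meets_def by (intro exI[of _ 0] exI[of _ 1]; simp) (intro exI[of _ 1] exI[of _ 0]; simp)

lemma rot_eq_conj:
  assumes "reduced (t # w)"
  shows "rot (t # w) = nf (neg t # (t # w) @ [t])"
  using assms nf_cancel_middle(2)[of t "[]" "w @ [t]"] by (auto simp: rot_def reduced_def)

lemma reduced_rot: "reduced w \<Longrightarrow> reduced (rot w)"
  unfolding rot_def by (rule reduced_nf) (auto simp: reduced_def)

lemma reduced_rot_funpow: "reduced w \<Longrightarrow> reduced ((rot ^^ i) w)"
  by (induction i) (auto simp: reduced_rot)

lemma nf_snoc_reduced:
  assumes "reduced (s @ [b])" "l < m"
  shows "nf (s @ [b, l]) = (if (b = 0) \<noteq> (l = 0) then s @ [b, l]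
     else if (b + l) mod m = 0 then s else s @ [(b + l) mod m])"
proof -
  have s: "reduced s" "s = [] \<or> (last s = 0) \<noteq> (b = 0)" "b < m"
    using assms by (auto simp: reduced_append)
  have *: "foldr act s w = s @ w" if "reduced (s @ w)" for w
    using that by (metis nf_append nf_reduced reduced_append)
  have "nf (s @ [b, l]) = foldr act s (act b [l])" by (simp add: nf_def)
  also have "act b [l] = (if (b = 0) \<noteq> (l = 0) then [b, l] else if (b + l) mod m = 0 then []
      else [(b + l) mod m])"
    by (auto simp: act_Cons)
  also have "foldr act s \<dots> = (if (b = 0) \<noteq> (l = 0) then s @ [b, l]
     else if (b + l) mod m = 0 then s else s @ [(b + l) mod m])"
    using s assms(2) * by (auto simp: reduced_append reduced_Cons)
  finally show ?thesis .
qed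

text \<open>Only the last letter of a reduced word is affected by a new letter at the end; the first one
  survives because it is not the last.\<close>

lemma nf_snoc_hd:
  assumes "reduced (t # s)" "s \<noteq> []" "l < m"
  shows "\<exists>r. nf (t # s @ [l]) = t # r"
proof -
  obtain s' b where s: "s = s' @ [b]" using assms(2) by (cases s rule: rev_cases) auto
  show ?thesis using nf_snoc_reduced[of "t # s'" b l] assms s by auto
qed

text \<open>Let \<open>t\<close> be the first letter of \<open>w\<close> and \<open>w'\<close> the conjugate of \<open>w\<close> by \<open>l\<close>. If \<open>l = t\<close> then \<open>w'\<close> is \<open>rot w\<close>. If
  \<open>l\<close> and \<open>t\<close> are of different kinds, then \<open>w'\<close> begins with the inverse of \<open>l\<close>, and \<open>rot\<close> undoes the
  conjugation. Otherwise \<open>l\<close> and \<open>t\<close> are powers of \<open>y\<close>, and unless \<open>w\<close> is a power of \<open>y\<close> itself, \<open>w'\<close> begins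
  with the product \<open>d\<close> of the inverse of \<open>l\<close> with \<open>t\<close>; conjugation by \<open>l\<close> and then by \<open>d\<close> is conjugation by \<open>t\<close>,
  so \<open>rot w' = rot w\<close>.\<close>

lemma meets_conj_letter:
  assumes w: "reduced w" and l: "l < m"
  shows "meets (nf (neg l # w @ [l])) w"
proof (cases w)
  case Nil
  then show ?thesis using l by (simp add: nf_cancel)
next
  case (Cons t r)
  define w' where "w' = nf (neg l # w @ [l])"
  have ww: "w \<in> words" "t < m" "r \<in> words" using w Cons by (auto simp: reduced_def)
  have w'r: "reduced w'" unfolding w'_def using ww l by (intro reduced_nf) auto
  have rot_w': "rot w' = nf (neg d # neg l # w @ [l, d])" if "w' = d # s" for d s
  proof -
    have d: "d < m" using w'r that by (auto simp: reduced_def)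
    have "rot w' = nf ((neg d # w') @ [d])" using rot_eq_conj[of d s] w'r that by simp
    also have "\<dots> = nf ([neg d] @ nf (neg l # w @ [l]) @ [d])" by (simp add: w'_def)
    also have "\<dots> = nf ([neg d] @ (neg l # w @ [l]) @ [d])"
      using ww l d by (intro nf_cong) (auto simp: nf_nf nf_words)
    finally show ?thesis by simp
  qed
  show ?thesis
  proof (cases "t = l")
    case True
    then show ?thesis using rot_eq_conj[of t r] w Cons meets_rot[of w] by simp
  next
    case tl: False
    show ?thesis
    proof (cases "(t = 0) \<noteq> (l = 0)")
      case True
      then have "reduced (neg l # w)" using w Cons l by (auto simp: reduced_Cons)
      then obtain s where "w' = neg l # s"
        using nf_snoc_hd[of "neg l" w l] Cons l by (auto simp: w'_def)
      from rot_w'[OF this] have "rot w' = nf (l # neg l # w @ [l, neg l])" using l by simp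
      also have "\<dots> = nf w"
        using nf_cancel_middle[of l "[]" "w @ [l, neg l]"] nf_cancel_middle[of l w "[]"] ww l by simp
      finally have "rot w' = w" using nf_reduced w by simp
      then show ?thesis using meets_rot[of w'] by (simp add: w'_def)
    next
      case False
      then have t0: "t \<noteq> 0" "l \<noteq> 0" using tl by auto
      define d where "d = (neg l + t) mod m"
      have ld: "(l + d) mod m = t"
      proof -
        have "(l + d) mod m = ((l + neg l) mod m + t) mod m" by (simp add: d_def mod_simps add.assoc)
        then show ?thesis using l ww by simp
      qed
      have d: "d < m" "d \<noteq> 0" using ld tl l by (simp add: d_def) (cases "d = 0"; use ld tl l in simp)
      show ?thesis
      proof (cases "r = []")
        case True
        \<comment> \<open>the word is a power of the second generator and commutes with the letter\<close>
        have "nf [t, l] = nf [l, t]" using t0 by (auto simp: nf_def act_Cons add.commute)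
        then have "nf ([neg l] @ [t, l] @ []) = nf ([neg l] @ [l, t] @ [])"
          using ww l by (intro nf_cong) auto
        also have "\<dots> = nf [t]" using nf_cancel_middle(2)[of l "[]" "[t]"] ww l by simp
        finally have "w' = w" using True Cons nf_reduced[OF w] by (simp add: w'_def)
        then show ?thesis by (simp add: w'_def)
      next
        case False
        have red: "reduced (d # r)" using w Cons d False t0 by (auto simp: reduced_Cons)
        have "nf (neg l # t # r @ [l]) = nf (d # r @ [l])"
        proof -
          have "nf [neg l, t] = nf [d]" using t0 l d by (auto simp: nf_def act_Cons d_def)
          then have "nf ([] @ [neg l, t] @ r @ [l]) = nf ([] @ [d] @ r @ [l])"
            using ww l d by (intro nf_cong) auto
          then show ?thesis by simp
        qed
        then obtain s where "w' = d # s" using nf_snoc_hd[OF red False l] Cons by (auto simp: w'_def)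
        from rot_w'[OF this] have "rot w' = nf (neg d # neg l # w @ [l, d])" .
        also have "\<dots> = nf ((neg d # neg l # w) @ [t] @ [])"
        proof -
          have "nf [l, d] = nf [t]" using t0 d ld by (auto simp: nf_def act_Cons)
          then have "nf ((neg d # neg l # w) @ [l, d] @ []) = nf ((neg d # neg l # w) @ [t] @ [])"
            using ww l d by (intro nf_cong) auto
          then show ?thesis by simp
        qed
        also have "\<dots> = nf (neg t # w @ [t])"
        proof -
          have "(neg d + neg l) mod m = neg t"
          proof -
            have "neg t = (m - (l + d) mod m) mod m" by (simp add: ld neg_def)
            moreover have "(l + d) mod m = (if l + d < m then l + d else l + d - m)"
              using l d by (simp add: mod_if le_mod_geq)
            moreover have "neg d = m - d" "neg l = m - l" using d t0 l by (auto simp: neg_def)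
            ultimately show ?thesis using l d t0 ld
              by (auto simp: mod_if le_mod_geq split: if_splits)
          qed
          then have "nf [neg d, neg l] = nf [neg t]" using t0 l d ww by (auto simp: nf_def act_Cons)
          then have "nf ([] @ [neg d, neg l] @ w @ [t]) = nf ([] @ [neg t] @ w @ [t])"
            using ww l d by (intro nf_cong) auto
          then show ?thesis by simp
        qed
        also have "\<dots> = rot w" using rot_eq_conj[of t r] w Cons by simp
        finally have "rot w' = rot w" .
        then have "meets w' w" unfolding meets_def by (intro exI[of _ 1]) simp
        then show ?thesis by (simp add: w'_def)
      qed
    qed
  qed
qed

lemma meets_conj:
  assumes "g \<in> words" "reduced w"
  shows "meets (nf (inv_of g @ w @ g)) w"
  using assms
proof (induction g arbitrary: w rule: list.induct)
  case Nil
  then show ?case by (simp add: nf_reduced)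
next
  case (Cons l g)
  have ww: "w \<in> words" "l < m" "g \<in> words" using Cons.prems by (auto simp: reduced_def)
  let ?v = "nf (neg l # w @ [l])"
  have v: "reduced ?v" using ww by (intro reduced_nf) auto
  have "nf (inv_of g @ ?v @ g) = nf (inv_of g @ (neg l # w @ [l]) @ g)"
    using ww by (intro nf_cong) (auto simp: nf_nf nf_words)
  then have "meets (nf (inv_of (l # g) @ w @ l # g)) ?v"
    using Cons.IH[OF ww(3) v] by simp
  then show ?case using meets_conj_letter[OF Cons.prems(2) ww(2)] meets_trans by blast
qed

lemma rot_funpow_conj:
  assumes "reduced w"
  shows "\<exists>g\<in>words. (rot ^^ i) w = nf (inv_of g @ w @ g)"
proof (induction i)
  case 0
  show ?case using assms by (intro bexI[of _ "[]"]) (auto simp: nf_reduced)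
next
  case (Suc i)
  then obtain g where g: "g \<in> words" "(rot ^^ i) w = nf (inv_of g @ w @ g)" by blast
  have ww: "w \<in> words" using assms by (simp add: reduced_def)
  have rot_Nil: "rot [] = []" by (simp add: rot_def nf_def)
  show ?case
  proof (cases "(rot ^^ i) w")
    case Nil
    have "(rot ^^ Suc i) w = rot ((rot ^^ i) w)" by simp
    also have "\<dots> = (rot ^^ i) w" unfolding Nil by (rule rot_Nil)
    finally show ?thesis using g by metis
  next
    case (Cons t r)
    have "reduced (t # r)" using reduced_rot_funpow[OF assms, of i] Cons by simp
    then have "t < m" by (simp add: reduced_Cons)
    have "(rot ^^ Suc i) w = nf ([neg t] @ (rot ^^ i) w @ [t])"
      using rot_eq_conj[OF \<open>reduced (t # r)\<close>] Cons by simp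
    also have "\<dots> = nf ([neg t] @ (inv_of g @ w @ g) @ [t])"
      using g ww \<open>t < m\<close> by (intro nf_cong) (auto simp: nf_nf nf_words)
    also have "\<dots> = nf (inv_of (g @ [t]) @ w @ g @ [t])" by simp
    finally show ?thesis using g \<open>t < m\<close> by (intro bexI[of _ "g @ [t]"]) auto
  qed
qed

lemma meets_imp_conj:
  assumes "meets u v" "reduced u" "reduced v"
  shows "\<exists>g\<in>words. u = nf (inv_of g @ v @ g)"
proof -
  obtain i j where ij: "(rot ^^ i) u = (rot ^^ j) v" using assms(1) by (auto simp: meets_def)
  obtain g where g: "g \<in> words" "(rot ^^ i) u = nf (inv_of g @ u @ g)"
    using rot_funpow_conj[OF assms(2)] by blast
  obtain h where h: "h \<in> words" "(rot ^^ j) v = nf (inv_of h @ v @ h)"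
    using rot_funpow_conj[OF assms(3)] by blast
  have ww: "u \<in> words" "v \<in> words" using assms by (auto simp: reduced_def)
  have "u = nf (g @ (inv_of g @ u @ g) @ inv_of g)"
    using nf_inv_of_middle(1)[of g "[]" "u @ g @ inv_of g"] nf_inv_of_middle(1)[of g u "[]"]
      g ww nf_reduced[OF assms(2)] by simp
  also have "\<dots> = nf (g @ (inv_of h @ v @ h) @ inv_of g)"
    using g h ij ww by (intro nf_cong) auto
  finally show ?thesis using g h ww by (intro bexI[of _ "h @ inv_of g"]) auto
qed

section \<open>Cyclically reduced words\<close>

text \<open>A single letter counts as cyclically reduced, although its square is not a reduced word.\<close>

definition cyc_reduced :: "nat list \<Rightarrow> bool" where
  "cyc_reduced w \<longleftrightarrow> reduced w \<and> (length w \<le> 1 \<or> reduced (w @ w))"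

lemma cyc_reduced_rotate1:
  assumes "cyc_reduced w"
  shows "cyc_reduced (rotate1 w)"
proof (cases w)
  case (Cons t r)
  then show ?thesis
    using assms by (cases "r = []") (auto simp: cyc_reduced_def reduced_append reduced_Cons)
qed (use assms in simp)

lemma rot_cyc_reduced: "cyc_reduced w \<Longrightarrow> rot w = rotate1 w"
  using cyc_reduced_rotate1 nf_reduced by (auto simp: rot_def cyc_reduced_def)

lemma rot_funpow_cyc_reduced:
  "cyc_reduced w \<Longrightarrow> (rot ^^ i) w = rotate i w \<and> cyc_reduced (rotate i w)"
  by (induction i) (auto simp: rot_cyc_reduced cyc_reduced_rotate1)

text \<open>If a reduced word is not cyclically reduced, then its first and last letter are of the same kind,
  and they cancel or merge when they become neighbours.\<close>

lemma length_rot_less: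
  assumes "reduced w" "\<not> cyc_reduced w"
  shows "length (rot w) < length w"
proof -
  have l: "\<not> length w \<le> 1" using assms by (auto simp: cyc_reduced_def)
  then obtain t r' where w': "w = t # r'" "r' \<noteq> []" by (cases w) auto
  then obtain r b where w: "w = t # r @ [b]" by (cases r' rule: rev_cases) auto
  have "\<not> reduced (w @ w)" using assms l by (simp add: cyc_reduced_def)
  then have "(last w = 0) = (hd w = 0)" using assms(1) unfolding reduced_append by blast
  then have "(b = 0) = (t = 0)" using w by simp
  moreover have "reduced (r @ [b])" "t < m" using assms(1) w by (auto simp: reduced_Cons)
  ultimately show ?thesis using nf_snoc_reduced[of r b t] w by (auto simp: rot_def)
qed

lemma length_rot_le:
  assumes "reduced w"
  shows "length (rot w) \<le> length w"
  using length_rot_less[OF assms] rot_cyc_reduced[of w] by (cases "cyc_reduced w") auto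

lemma length_rot_funpow_le: "reduced w \<Longrightarrow> length ((rot ^^ i) w) \<le> length w"
  by (induction i) (auto intro: le_trans length_rot_le reduced_rot_funpow)

lemma cyc_reduced_rot_funpow:
  assumes "reduced w" "length w \<le> i"
  shows "cyc_reduced ((rot ^^ i) w)"
  using assms
proof (induction i arbitrary: w)
  case 0
  then show ?case by (simp add: cyc_reduced_def)
next
  case (Suc i)
  show ?case
  proof (cases "cyc_reduced w")
    case True
    then show ?thesis using rot_funpow_cyc_reduced[of w "Suc i"] by simp
  next
    case False
    then have "length (rot w) \<le> i" using length_rot_less[of w] Suc.prems by simp
    from Suc.IH[OF reduced_rot[OF Suc.prems(1)] this] show ?thesis
      by (simp add: funpow_Suc_right del: funpow.simps)
  qed
qed

text \<open>After \<open>length u\<close> steps the orbit of \<open>u\<close> consists of the rotations of one word, of which there are at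
  most \<open>length u\<close>. After \<open>N\<close> steps the orbit of \<open>v\<close> has reached its cycle, too; if the orbits meet, they end in
  the same cycle, so that the orbit of \<open>u\<close> passes through every point of it.\<close>

lemma meets_bounded:
  assumes "reduced u" "reduced v" "length v \<le> N" "2 * length u < K"
  shows "meets u v \<longleftrightarrow> (\<exists>i<K. (rot ^^ i) u = (rot ^^ N) v)"
proof
  assume "\<exists>i<K. (rot ^^ i) u = (rot ^^ N) v"
  then show "meets u v" by (auto simp: meets_def)
next
  assume uv: "meets u v"
  define c where "c = (rot ^^ length u) u"
  define d where "d = (rot ^^ N) v"
  have c: "cyc_reduced c" and d: "cyc_reduced d"
    using assms by (auto simp: c_def d_def intro: cyc_reduced_rot_funpow)
  have len: "length c \<le> length u" unfolding c_def by (rule length_rot_funpow_le[OF assms(1)])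
  have "meets c u" "meets v d" unfolding meets_def c_def d_def
    by (rule exI[of _ 0], rule exI, simp, rule exI, rule exI[of _ 0], simp)
  then have "meets c d" using uv meets_trans by blast
  then obtain i j where "(rot ^^ i) c = (rot ^^ j) d" by (auto simp: meets_def)
  then have ij: "rotate i c = rotate j d" using rot_funpow_cyc_reduced c d by metis
  \<comment> \<open>a multiple of the length of the cycle, split so that the last j steps are those of the meeting point\<close>
  have "d = rotate (length d * j - j + j) d"
  proof (cases "d = []")
    case False
    then have "length d * j - j + j = length d * j" by (cases d) auto
    then show ?thesis by (simp add: rotate_id)
  qed simp
  also have "\<dots> = rotate (length d * j - j + i) c"
    using ij by (metis rotate_rotate)
  also have "\<dots> = rotate ((length d * j - j + i) mod length c) c"
    by (rule rotate_conv_mod)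
  finally have d_eq: "d = rotate ((length d * j - j + i) mod length c) c" .
  define q where "q = (if c = [] then 0 else (length d * j - j + i) mod length c)"
  have q: "d = rotate q c" "q \<le> length c" using d_eq by (auto simp: q_def less_imp_le)
  then have "d = (rot ^^ (q + length u)) u"
    using rot_funpow_cyc_reduced[OF c, of q] by (simp add: c_def funpow_add)
  moreover have "q + length u < K" using q len assms(4) by simp
  ultimately show "\<exists>i<K. (rot ^^ i) u = (rot ^^ N) v" unfolding d_def by metis
qed

subsection \<open>Centre and substitutions\<close>

text \<open>A word that commutes with \<open>x\<close> is empty or \<open>x\<close>: otherwise the lengths or the first letters of the two
  products differ. And \<open>x\<close> does not commute with \<open>y\<close>.\<close>

lemma centre_trivial:
  assumes "reduced w" "nf (w @ [0]) = nf (0 # w)" "nf (w @ [1]) = nf (1 # w)"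
  shows "w = []"
proof (rule ccontr)
  assume "w \<noteq> []"
  then obtain t r where w: "w = t # r" by (cases w) auto
  obtain s b where w': "w = s @ [b]" using \<open>w \<noteq> []\<close> by (cases w rule: rev_cases) auto
  have snoc: "nf (w @ [0]) = (if b = 0 then s else w @ [0])"
    using nf_snoc_reduced[of s b 0] assms(1) w' by (auto simp: reduced_append)
  have cons: "nf (0 # w) = (if t = 0 then r else 0 # w)"
    using nf_reduced[OF assms(1)] by (simp add: nf_def w act_Cons)
  have len: "length s = length r" using w w' by (metis length_Cons length_append_singleton nat.inject)
  have "w = [0]"
  proof (cases "t = 0")
    case True
    then have "b = 0" using snoc cons assms(2) w len by (auto split: if_splits)
    then have "s = r" using snoc cons assms(2) True by simp
    then show ?thesis using w w' True assms(1) by (cases r) (auto simp: reduced_Cons)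
  next
    case False
    then have "w @ [0] = 0 # w" using snoc cons assms(2) w w' by (auto split: if_splits)
    then show ?thesis using False w by simp
  qed
  then show False using assms(3) m_ge_2 by (simp add: nf_def act_Cons)
qed

lemma reduced_map:
  assumes "reduced w" and "\<And>l. l < m \<Longrightarrow> \<nu> l < m" and "\<And>l. l < m \<Longrightarrow> (\<nu> l = 0) = (l = 0)"
  shows "reduced (map \<nu> w)"
  using assms(1)
proof (induction w)
  case (Cons l w)
  then have "w \<noteq> [] \<Longrightarrow> hd w < m" by (cases w) (auto simp: reduced_Cons)
  then show ?case
    using Cons assms(2)[of l] assms(3)[of l] assms(3)[of "hd w"] by (auto simp: reduced_Cons hd_map)
qed simp

text \<open>The image of a letter under the endomorphism that fixes \<open>x\<close> and sends \<open>y\<^sup>l\<close> to the conjugate of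
  \<open>y\<close> to the power \<open>\<nu> l\<close> by \<open>h\<close>; the map \<open>\<nu>\<close> allows for \<open>y\<close> being inverted on the way.\<close>

definition sandwich :: "(nat \<Rightarrow> nat) \<Rightarrow> nat list \<Rightarrow> nat \<Rightarrow> nat list" where
  "sandwich \<nu> h l = (if l = 0 then [0] else h @ [\<nu> l] @ inv_of h)"

text \<open>If \<open>h\<close> begins with a power of \<open>y\<close> and ends with \<open>x\<close>, then the image of a letter begins and ends with
  letters of the same kind as the letter itself. Hence no cancellation occurs between the images of
  neighbours in a reduced word.\<close>

lemma reduced_concat_sandwich:
  assumes h: "reduced h" "h \<noteq> []" "hd h \<noteq> 0" "last h = 0"
    and \<nu>: "\<And>l. l < m \<Longrightarrow> \<nu> l < m" "\<And>l. l < m \<Longrightarrow> (\<nu> l = 0) = (l = 0)"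
    and w: "reduced w"
  shows "reduced (concat (map (sandwich \<nu> h) w)) \<and>
    (w \<noteq> [] \<longrightarrow> concat (map (sandwich \<nu> h) w) \<noteq> [] \<and> (hd (concat (map (sandwich \<nu> h) w)) = 0) = (hd w = 0))"
  using w
proof (induction w rule: list.induct)
  case (Cons l w)
  have l: "l < m" and w: "reduced w" "w = [] \<or> (l = 0) \<noteq> (hd w = 0)"
    using Cons.prems by (auto simp: reduced_Cons)
  have "hd h < m" using h(1,2) by (cases h) (auto simp: reduced_Cons)
  have inv: "inv_of h \<noteq> []" "hd (inv_of h) = 0" "last (inv_of h) \<noteq> 0"
    using h \<open>hd h < m\<close> by (auto simp: inv_of_def hd_rev last_rev last_map hd_map)
  have s: "reduced (sandwich \<nu> h l)" "sandwich \<nu> h l \<noteq> []" "(hd (sandwich \<nu> h l) = 0) = (l = 0)"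
    "(last (sandwich \<nu> h l) = 0) = (l = 0)"
    using h inv \<nu>(1)[OF l] \<nu>(2)[OF l] reduced_inv_of[OF h(1)] by (auto simp: sandwich_def reduced_append reduced_Cons)
  show ?case using s Cons.IH[OF w(1)] w(2) by (auto simp: reduced_append)
qed simp

end

section \<open>Normal forms in the dihedral Artin group\<close>

lemma alternating_Suc_even: "alternating (Suc (2 * j)) x y = alternating (2 * j) x y @ [x]"
  by (induction j) auto

locale odd_dihedral_artin =
  fixes m k :: nat
  assumes m_eq: "m = Suc (2 * k)" and k_pos: "1 \<le> k"
begin

sublocale free_product_cyclic m
  using m_eq k_pos by unfold_locales simp

abbreviation R :: "(dgen gword \<times> dgen gword) set" where
  "R \<equiv> {(alternating m (GenA, True) (GenB, True), alternating m (GenB, True) (GenA, True))}"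

abbreviation G :: "dgen gword set monoid" where
  "G \<equiv> dihedral_artin m"

definition cls :: "dgen gword \<Rightarrow> dgen gword set" where
  "cls u = pres_class R u"

lemma cls_eq_iff: "cls u = cls v \<longleftrightarrow> pres_eq R u v"
  unfolding cls_def by (rule pres_class_eq_iff)

sublocale G: group G
  unfolding dihedral_artin_def by (rule group_presented_group)

lemma cls_mult: "cls u \<otimes>\<^bsub>G\<^esub> cls v = cls (u @ v)"
  unfolding dihedral_artin_def cls_def by (rule pres_class_mult)

lemma one_cls: "\<one>\<^bsub>G\<^esub> = cls []"
  by (simp add: dihedral_artin_def presented_group_def cls_def[abs_def])

lemma carrier_G: "carrier G = range cls"
  by (simp add: dihedral_artin_def presented_group_def cls_def[abs_def])

lemma cls_carrier [simp]: "cls u \<in> carrier G" by (simp add: carrier_G)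

text \<open>The images of \<open>a\<close>, \<open>b\<close> and their inverses in the free product. From \<open>x = y\<^sup>k a = b y\<^sup>k\<close> one gets
  \<open>a = y\<^sup>-\<^sup>k x\<close> and \<open>b = x y\<^sup>-\<^sup>k\<close>, and \<open>y\<^sup>-\<^sup>k\<close> is \<open>y\<close> to the power \<open>k + 1\<close> there.\<close>

definition letter_word :: "dgen \<times> bool \<Rightarrow> nat list" where
  "letter_word l = (case l of (GenA, e) \<Rightarrow> if e then [Suc k, 0] else [0, k]
     | (GenB, e) \<Rightarrow> if e then [0, Suc k] else [k, 0])"

definition gword_nf :: "dgen gword \<Rightarrow> nat list" where
  "gword_nf u = nf (concat (map letter_word u))"

definition exponent_sum :: "dgen gword \<Rightarrow> int" where
  "exponent_sum u = sum_list (map (\<lambda>l. if snd l then 1 else - 1) u)"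

lemma k_simps [simp]: "k < m" "Suc k < m" "0 < k" "Suc 0 < m" "Suc (Suc (k + k)) mod m = Suc 0"
    "Suc (k + k) mod m = 0"
  using m_eq k_pos by (simp_all add: mod_if mult_2)

lemma letter_word_words [simp]: "letter_word l \<in> words"
  by (auto simp: letter_word_def split: prod.splits dgen.splits)

lemma concat_letter_words [simp]: "concat (map letter_word u) \<in> words"
  by (induction u) auto

lemma alternating_m:
  "alternating m (GenA, True) (GenB, True) = alternating (2 * k) (GenA, True) (GenB, True) @ [(GenA, True)]"
  "alternating m (GenB, True) (GenA, True) = (GenB, True) # alternating (2 * k) (GenA, True) (GenB, True)"
  using alternating_Suc_even[of k] unfolding m_eq by simp_all

lemma nf_replicate_1: "j < m \<Longrightarrow> nf (replicate j 1) = (if j = 0 then [] else [j])"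
  by (induction j) (auto simp: nf_def act_Cons)

lemma nf_alternating:
  assumes "p \<in> words" "s \<in> words"
  shows "nf (p @ concat (map letter_word (alternating (2 * j) (GenA, True) (GenB, True))) @ s) =
    nf (p @ replicate j 1 @ s)"
  using assms(1)
proof (induction j arbitrary: p rule: nat.induct)
  case (Suc j)
  let ?w = "concat (map letter_word (alternating (2 * j) (GenA, True) (GenB, True)))"
  have "nf [Suc k, 0, 0, Suc k] = nf [1]"
    by (simp add: nf_def act_Cons)
  then have "nf (p @ [Suc k, 0, 0, Suc k] @ ?w @ s) = nf (p @ [1] @ ?w @ s)"
    using Suc.prems assms(2) by (intro nf_cong) (simp_all only: concat_letter_words append_in_lists_conv, simp_all)
  also have "\<dots> = nf ((p @ [1]) @ replicate j 1 @ s)"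
    using Suc.IH[of "p @ [1]"] Suc.prems by simp
  finally show ?case by (simp add: letter_word_def[of "(GenA, True)"] letter_word_def[of "(GenB, True)"])
qed simp

lemma gword_nf_relation:
  "gword_nf (alternating m (GenA, True) (GenB, True)) = [0]"
  "gword_nf (alternating m (GenB, True) (GenA, True)) = [0]"
proof -
  have k1: "nf (replicate k 1) = nf [k]"
    using nf_replicate_1[of k] by (simp add: nf_def)
  have s: "[Suc k, 0] \<in> words" "[0, Suc k] \<in> words" "[k] \<in> words" "replicate k 1 \<in> words"
    by auto
  have "gword_nf (alternating m (GenA, True) (GenB, True)) = nf ([] @ replicate k 1 @ [Suc k, 0])"
    using nf_alternating[of "[]" "[Suc k, 0]" k] s
    by (simp add: gword_nf_def letter_word_def alternating_m)
  also have "\<dots> = nf ([] @ [k] @ [Suc k, 0])" by (rule nf_cong[OF k1]) (use s in auto)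
  also have "\<dots> = [0]" by (simp add: nf_def act_Cons)
  finally show "gword_nf (alternating m (GenA, True) (GenB, True)) = [0]" .
  have "gword_nf (alternating m (GenB, True) (GenA, True)) = nf ([0, Suc k] @ replicate k 1 @ [])"
    using nf_alternating[of "[0, Suc k]" "[]" k] s
    by (simp add: gword_nf_def letter_word_def alternating_m)
  also have "\<dots> = nf ([0, Suc k] @ [k] @ [])" by (rule nf_cong[OF k1]) (use s in auto)
  also have "\<dots> = [0]" by (simp add: nf_def act_Cons)
  finally show "gword_nf (alternating m (GenB, True) (GenA, True)) = [0]" .
qed

lemma exponent_sum_append [simp]: "exponent_sum (u @ v) = exponent_sum u + exponent_sum v"
  by (simp add: exponent_sum_def)

lemma exponent_sum_alternating:
  "exponent_sum (alternating n (x, True) (y, True)) = int n"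
  by (induction n arbitrary: x y) (auto simp: exponent_sum_def)

lemma gword_nf_append: "gword_nf (u @ v) = nf (gword_nf u @ gword_nf v)"
  by (simp add: gword_nf_def nf_words)

lemma pres_eq_invariants:
  assumes "pres_eq R u v"
  shows "gword_nf u = gword_nf v" and "exponent_sum u = exponent_sum v"
proof -
  have "gword_nf u = gword_nf v \<and> exponent_sum u = exponent_sum v"
    using assms
  proof (induction rule: pres_eq.induct)
    case (cancel u x e v)
    have "nf (letter_word (x, e) @ letter_word (x, \<not> e)) = nf []"
      by (cases x; cases e) (simp_all add: letter_word_def nf_def act_Cons)
    then have "nf (concat (map letter_word u) @ (letter_word (x, e) @ letter_word (x, \<not> e)) @
        concat (map letter_word v)) = nf (concat (map letter_word u) @ [] @ concat (map letter_word v))"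
      by (intro nf_cong) (auto)
    then show ?case by (simp add: gword_nf_def exponent_sum_def)
  next
    case (rel r s u v)
    then have "gword_nf r = gword_nf s" "exponent_sum r = exponent_sum s"
      by (auto simp: gword_nf_relation exponent_sum_alternating)
    then show ?case by (simp add: gword_nf_append)
  qed auto
  then show "gword_nf u = gword_nf v" and "exponent_sum u = exponent_sum v" by auto
qed

text \<open>The image of a group element in the free product, as a reduced word, and its image in the infinite
  cyclic abelianization. Both are well defined by \<open>pres_eq_invariants\<close>.\<close>

definition N :: "dgen gword set \<Rightarrow> nat list" where
  "N g = gword_nf (SOME u. g = cls u)"

definition E :: "dgen gword set \<Rightarrow> int" where
  "E g = exponent_sum (SOME u. g = cls u)"

lemma N_cls: "N (cls u) = gword_nf u" and E_cls: "E (cls u) = exponent_sum u"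
proof -
  have "cls u = cls (SOME v. cls u = cls v)" by (rule someI_ex) blast
  then have "pres_eq R (SOME v. cls u = cls v) u" using cls_eq_iff by metis
  then show "N (cls u) = gword_nf u" and "E (cls u) = exponent_sum u"
    unfolding N_def E_def by (auto dest: pres_eq_invariants)
qed

lemma N_reduced: "g \<in> carrier G \<Longrightarrow> reduced (N g)"
  by (auto simp: carrier_G N_cls gword_nf_def reduced_nf[OF concat_letter_words])

lemma N_words: "g \<in> carrier G \<Longrightarrow> N g \<in> words"
  using N_reduced reduced_words by blast

lemma N_mult: "g \<in> carrier G \<Longrightarrow> h \<in> carrier G \<Longrightarrow> N (g \<otimes>\<^bsub>G\<^esub> h) = nf (N g @ N h)"
  by (auto simp: carrier_G cls_mult N_cls gword_nf_append)

lemma E_mult: "g \<in> carrier G \<Longrightarrow> h \<in> carrier G \<Longrightarrow> E (g \<otimes>\<^bsub>G\<^esub> h) = E g + E h"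
  by (auto simp: carrier_G cls_mult E_cls)

lemma N_one [simp]: "N \<one>\<^bsub>G\<^esub> = []" and E_one [simp]: "E \<one>\<^bsub>G\<^esub> = 0"
  by (simp_all add: one_cls N_cls E_cls gword_nf_def exponent_sum_def nf_def)

lemma E_inv: "g \<in> carrier G \<Longrightarrow> E (inv\<^bsub>G\<^esub> g) = - E g"
  using E_mult[of g "inv\<^bsub>G\<^esub> g"] by simp

lemma E_nat_pow: "g \<in> carrier G \<Longrightarrow> E (g [^]\<^bsub>G\<^esub> (n::nat)) = int n * E g"
  by (induction n) (auto simp: E_mult algebra_simps)

lemma E_int_pow: "g \<in> carrier G \<Longrightarrow> E (g [^]\<^bsub>G\<^esub> (n::int)) = n * E g"
  by (cases n rule: int_cases2) (simp_all add: int_pow_int E_nat_pow G.int_pow_neg E_inv)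

lemma N_inv:
  assumes "g \<in> carrier G"
  shows "N (inv\<^bsub>G\<^esub> g) = inv_of (N g)"
proof -
  have "nf (inv_of (N g)) = nf (N (inv\<^bsub>G\<^esub> g) @ N g @ inv_of (N g))"
    using assms N_mult[of "inv\<^bsub>G\<^esub> g" g] nf_append_nf(1)[of "N (inv\<^bsub>G\<^esub> g) @ N g" "inv_of (N g)"]
      N_words[of g] N_words[of "inv\<^bsub>G\<^esub> g"] by simp
  also have "\<dots> = nf (N (inv\<^bsub>G\<^esub> g))"
    using nf_inv_of_middle(1)[of "N g" "N (inv\<^bsub>G\<^esub> g)" "[]"] assms
    by (simp add: N_words)
  finally show ?thesis
    using nf_reduced[OF reduced_inv_of[OF N_reduced[OF assms]]] nf_reduced[of "N (inv\<^bsub>G\<^esub> g)"] assms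
    by (simp add: N_reduced)
qed

definition ga :: "dgen gword set" where "ga = cls [(GenA, True)]"
definition gb :: "dgen gword set" where "gb = cls [(GenB, True)]"
text \<open>The generators \<open>x\<close> and \<open>y\<close> with \<open>x\<^sup>2 = y\<^sup>m\<close>, and the generator \<open>z\<close> of the centre.\<close>

definition gy :: "dgen gword set" where "gy = ga \<otimes>\<^bsub>G\<^esub> gb"
definition gx :: "dgen gword set" where "gx = gy [^]\<^bsub>G\<^esub> k \<otimes>\<^bsub>G\<^esub> ga"
definition gz :: "dgen gword set" where "gz = gx \<otimes>\<^bsub>G\<^esub> gx"

lemma gen_carrier [simp]:
  "ga \<in> carrier G" "gb \<in> carrier G" "gy \<in> carrier G" "gx \<in> carrier G" "gz \<in> carrier G"
  by (simp_all add: ga_def gb_def gy_def gx_def gz_def)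

lemma cls_alternating: "cls (alternating (2 * j) (GenA, True) (GenB, True)) = gy [^]\<^bsub>G\<^esub> j"
proof (induction j)
  case (Suc j)
  have "cls (alternating (2 * Suc j) (GenA, True) (GenB, True)) =
      cls [(GenA, True)] \<otimes>\<^bsub>G\<^esub> cls [(GenB, True)] \<otimes>\<^bsub>G\<^esub>
      cls (alternating (2 * j) (GenA, True) (GenB, True))"
    by (simp add: cls_mult)
  then show ?case using G.nat_pow_Suc2[of gy j] Suc by (simp add: gy_def ga_def gb_def)
qed (simp add: one_cls)

lemma gx_cls: "gx = cls (alternating m (GenA, True) (GenB, True))"
  unfolding alternating_m(1) gx_def ga_def cls_alternating[symmetric] by (simp only: cls_mult)

text \<open>This is the defining relation of the dihedral Artin group, read in terms of \<open>y\<close>.\<close>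

lemma gx_eq: "gx = gb \<otimes>\<^bsub>G\<^esub> gy [^]\<^bsub>G\<^esub> k"
proof -
  have "cls (alternating m (GenA, True) (GenB, True)) = cls (alternating m (GenB, True) (GenA, True))"
    unfolding cls_eq_iff using pres_eq.rel[of _ _ R "[]" "[]"] by simp
  moreover have "cls (alternating m (GenB, True) (GenA, True)) = gb \<otimes>\<^bsub>G\<^esub> gy [^]\<^bsub>G\<^esub> k"
    unfolding alternating_m(2) gb_def cls_alternating[symmetric] by (simp only: cls_mult append_Cons append_Nil)
  ultimately show ?thesis by (simp add: gx_cls)
qed

lemma gz_eq: "gz = gy [^]\<^bsub>G\<^esub> m"
proof -
  have "gz = (gy [^]\<^bsub>G\<^esub> k \<otimes>\<^bsub>G\<^esub> ga) \<otimes>\<^bsub>G\<^esub> (gb \<otimes>\<^bsub>G\<^esub> gy [^]\<^bsub>G\<^esub> k)"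
    unfolding gz_def using gx_eq gx_def by metis
  also have "\<dots> = gy [^]\<^bsub>G\<^esub> k \<otimes>\<^bsub>G\<^esub> gy \<otimes>\<^bsub>G\<^esub> gy [^]\<^bsub>G\<^esub> k"
    by (simp add: gy_def G.m_assoc)
  also have "\<dots> = gy [^]\<^bsub>G\<^esub> (Suc k + k)"
    using G.nat_pow_mult[of gy "Suc k" k] by simp
  finally show ?thesis by (simp add: m_eq mult_2)
qed

lemma cls_inv_letter: "cls [(x, False)] = inv\<^bsub>G\<^esub> cls [(x, True)]"
proof (rule G.inv_equality[symmetric])
  show "cls [(x, False)] \<otimes>\<^bsub>G\<^esub> cls [(x, True)] = \<one>\<^bsub>G\<^esub>"
    unfolding cls_mult one_cls cls_eq_iff using pres_eq.cancel[of R "[]" x False "[]"] by simp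
qed simp_all

text \<open>As a power of \<open>x\<close> and of \<open>y\<close>, the element \<open>z\<close> commutes with both, hence with \<open>a\<close> and \<open>b\<close>, which are
  expressed by \<open>x\<close> and \<open>y\<close>.\<close>

lemma gz_commute:
  assumes "g \<in> carrier G"
  shows "gz \<otimes>\<^bsub>G\<^esub> g = g \<otimes>\<^bsub>G\<^esub> gz"
proof -
  have x: "gz \<otimes>\<^bsub>G\<^esub> gx = gx \<otimes>\<^bsub>G\<^esub> gz" by (simp add: gz_def G.m_assoc)
  have y: "gz \<otimes>\<^bsub>G\<^esub> gy [^]\<^bsub>G\<^esub> j = gy [^]\<^bsub>G\<^esub> j \<otimes>\<^bsub>G\<^esub> gz" for j :: nat
    by (simp add: gz_eq G.nat_pow_mult add.commute)
  have "gy [^]\<^bsub>G\<^esub> k \<otimes>\<^bsub>G\<^esub> (gz \<otimes>\<^bsub>G\<^esub> ga) = gz \<otimes>\<^bsub>G\<^esub> (gy [^]\<^bsub>G\<^esub> k \<otimes>\<^bsub>G\<^esub> ga)"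
    using y[of k] by (simp flip: G.m_assoc)
  also have "\<dots> = gy [^]\<^bsub>G\<^esub> k \<otimes>\<^bsub>G\<^esub> (ga \<otimes>\<^bsub>G\<^esub> gz)"
    using x by (simp add: gx_def G.m_assoc)
  finally have a: "gz \<otimes>\<^bsub>G\<^esub> ga = ga \<otimes>\<^bsub>G\<^esub> gz" by simp
  have "(gz \<otimes>\<^bsub>G\<^esub> gb) \<otimes>\<^bsub>G\<^esub> gy [^]\<^bsub>G\<^esub> k = (gb \<otimes>\<^bsub>G\<^esub> gy [^]\<^bsub>G\<^esub> k) \<otimes>\<^bsub>G\<^esub> gz"
    using x by (simp add: gx_eq G.m_assoc)
  also have "\<dots> = (gb \<otimes>\<^bsub>G\<^esub> gz) \<otimes>\<^bsub>G\<^esub> gy [^]\<^bsub>G\<^esub> k"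
    using y[of k] by (simp add: G.m_assoc)
  finally have b: "gz \<otimes>\<^bsub>G\<^esub> gb = gb \<otimes>\<^bsub>G\<^esub> gz" by simp
  have letter: "gz \<otimes>\<^bsub>G\<^esub> cls [l] = cls [l] \<otimes>\<^bsub>G\<^esub> gz" for l
  proof -
    have pos: "gz \<otimes>\<^bsub>G\<^esub> cls [(x, True)] = cls [(x, True)] \<otimes>\<^bsub>G\<^esub> gz" for x
      using a b by (cases x) (simp_all add: ga_def gb_def)
    obtain x e where l: "l = (x, e)" by (cases l)
    show ?thesis
    proof (cases e)
      case True
      then show ?thesis using pos l by simp
    next
      case False
      then show ?thesis
        using G.commute_inv[OF gen_carrier(5) cls_carrier pos[of x]] l by (simp add: cls_inv_letter)
    qed
  qed
  obtain u where "g = cls u" using assms by (auto simp: carrier_G)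
  moreover have "gz \<otimes>\<^bsub>G\<^esub> cls u = cls u \<otimes>\<^bsub>G\<^esub> gz"
  proof (induction u)
    case (Cons l u)
    have "cls (l # u) = cls [l] \<otimes>\<^bsub>G\<^esub> cls u" by (simp add: cls_mult)
    then show ?case using letter[of l] Cons.IH by (metis G.m_assoc cls_carrier gen_carrier(5))
  qed (simp flip: one_cls)
  ultimately show ?thesis by simp
qed

section \<open>Conjugacy in the dihedral Artin group\<close>

text \<open>A section of \<open>N\<close>: the group element that a word in \<open>x\<close> and \<open>y\<close> spells.\<close>

definition elt_of_letter :: "nat \<Rightarrow> dgen gword set" where
  "elt_of_letter l = (if l = 0 then gx else gy [^]\<^bsub>G\<^esub> l)"

definition elt_of :: "nat list \<Rightarrow> dgen gword set" where
  "elt_of w = foldr (\<lambda>l g. elt_of_letter l \<otimes>\<^bsub>G\<^esub> g) w \<one>\<^bsub>G\<^esub>"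

lemma elt_of_letter_carrier [simp]: "elt_of_letter l \<in> carrier G"
  by (simp add: elt_of_letter_def)

lemma elt_of_carrier [simp]: "elt_of w \<in> carrier G"
  by (induction w) (auto simp: elt_of_def)

lemma elt_of_simps [simp]: "elt_of [] = \<one>\<^bsub>G\<^esub>" "elt_of (l # w) = elt_of_letter l \<otimes>\<^bsub>G\<^esub> elt_of w"
  by (simp_all add: elt_of_def)

lemma elt_of_append: "elt_of (u @ v) = elt_of u \<otimes>\<^bsub>G\<^esub> elt_of v"
  by (induction u) (auto simp: G.m_assoc)

lemma N_gx [simp]: "N gx = [0]" and E_gx [simp]: "E gx = int m"
  by (simp_all add: gx_cls N_cls E_cls gword_nf_relation exponent_sum_alternating)

lemma N_gy [simp]: "N gy = [1]" and E_gy [simp]: "E gy = 2"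
  by (simp_all add: gy_def ga_def gb_def cls_mult N_cls E_cls gword_nf_def letter_word_def
      exponent_sum_def nf_def act_Cons)

lemma N_gz [simp]: "N gz = []" and E_gz [simp]: "E gz = 2 * int m"
  by (simp_all add: gz_def N_mult E_mult nf_def act_Cons)

lemma N_gy_pow: "j < m \<Longrightarrow> N (gy [^]\<^bsub>G\<^esub> j) = (if j = 0 then [] else [j])"
  by (induction j) (auto simp: N_mult nf_def act_Cons)

lemma N_elt_of_letter: "l < m \<Longrightarrow> N (elt_of_letter l) = [l]"
  by (simp add: elt_of_letter_def N_gy_pow)

lemma N_elt_of: "w \<in> words \<Longrightarrow> N (elt_of w) = nf w"
proof (induction w)
  case (Cons l w)
  then show ?case using nf_append_nf(2)[of "[l]" w] by (simp add: N_mult N_elt_of_letter)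
qed (simp add: nf_def)

definition eq_mod_centre :: "dgen gword set \<Rightarrow> dgen gword set \<Rightarrow> bool" where
  "eq_mod_centre g h \<longleftrightarrow> (\<exists>n::int. g = h \<otimes>\<^bsub>G\<^esub> gz [^]\<^bsub>G\<^esub> n)"

lemma gz_pow_commute:
  assumes "g \<in> carrier G"
  shows "gz [^]\<^bsub>G\<^esub> (n::int) \<otimes>\<^bsub>G\<^esub> g = g \<otimes>\<^bsub>G\<^esub> gz [^]\<^bsub>G\<^esub> n"
proof -
  have nat: "g \<otimes>\<^bsub>G\<^esub> gz [^]\<^bsub>G\<^esub> j = gz [^]\<^bsub>G\<^esub> j \<otimes>\<^bsub>G\<^esub> g" for j :: nat
  proof (induction j)
    case (Suc j)
    have "g \<otimes>\<^bsub>G\<^esub> gz [^]\<^bsub>G\<^esub> Suc j = (g \<otimes>\<^bsub>G\<^esub> gz [^]\<^bsub>G\<^esub> j) \<otimes>\<^bsub>G\<^esub> gz"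
      using assms by (simp add: G.m_assoc)
    also have "\<dots> = gz [^]\<^bsub>G\<^esub> Suc j \<otimes>\<^bsub>G\<^esub> g"
      using assms unfolding Suc.IH by (simp add: G.m_assoc gz_commute)
    finally show ?case .
  qed (use assms in simp)
  show ?thesis
    using nat G.commute_inv[OF assms _ nat] assms
    by (cases n rule: int_cases2) (simp_all add: int_pow_int G.int_pow_neg)
qed

lemma eq_mod_centre_refl: "g \<in> carrier G \<Longrightarrow> eq_mod_centre g g"
  unfolding eq_mod_centre_def by (intro exI[of _ 0]) simp

lemma eq_mod_centre_gz: "g \<in> carrier G \<Longrightarrow> eq_mod_centre (g \<otimes>\<^bsub>G\<^esub> gz) g"
  unfolding eq_mod_centre_def by (intro exI[of _ 1]) simp

lemma eq_mod_centre_sym: "h \<in> carrier G \<Longrightarrow> eq_mod_centre g h \<Longrightarrow> eq_mod_centre h g"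
proof -
  assume h: "h \<in> carrier G" and "eq_mod_centre g h"
  then obtain n :: int where "g = h \<otimes>\<^bsub>G\<^esub> gz [^]\<^bsub>G\<^esub> n" by (auto simp: eq_mod_centre_def)
  then have "h = g \<otimes>\<^bsub>G\<^esub> gz [^]\<^bsub>G\<^esub> (- n)" using h by (simp add: G.m_assoc flip: G.int_pow_mult)
  then show "eq_mod_centre h g" by (auto simp: eq_mod_centre_def)
qed

lemma eq_mod_centre_trans: "f \<in> carrier G \<Longrightarrow> eq_mod_centre g h \<Longrightarrow> eq_mod_centre h f \<Longrightarrow> eq_mod_centre g f"
  unfolding eq_mod_centre_def by (auto simp: G.m_assoc simp flip: G.int_pow_mult)

lemma eq_mod_centre_mult_left:
  "f \<in> carrier G \<Longrightarrow> h \<in> carrier G \<Longrightarrow> eq_mod_centre g h \<Longrightarrow> eq_mod_centre (f \<otimes>\<^bsub>G\<^esub> g) (f \<otimes>\<^bsub>G\<^esub> h)"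
  unfolding eq_mod_centre_def by (auto simp: G.m_assoc)

lemma eq_mod_centre_mult_right:
  "f \<in> carrier G \<Longrightarrow> h \<in> carrier G \<Longrightarrow> eq_mod_centre g h \<Longrightarrow> eq_mod_centre (g \<otimes>\<^bsub>G\<^esub> f) (h \<otimes>\<^bsub>G\<^esub> f)"
  unfolding eq_mod_centre_def by (auto simp: G.m_assoc gz_pow_commute)

lemma eq_mod_centre_gz_left: "g \<in> carrier G \<Longrightarrow> eq_mod_centre (gz \<otimes>\<^bsub>G\<^esub> g) g"
  by (simp add: gz_commute eq_mod_centre_gz)

text \<open>A reduction step in the free product uses \<open>x\<^sup>2 = 1\<close> or \<open>y\<^sup>m = 1\<close>; in the group it splits off one
  factor \<open>z = x\<^sup>2 = y\<^sup>m\<close>, which is central.\<close>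

lemma eq_mod_centre_act:
  assumes "reduced w" "l < m"
  shows "eq_mod_centre (elt_of (l # w)) (elt_of (act l w))"
proof (cases w)
  case Nil
  then show ?thesis by (simp add: eq_mod_centre_refl)
next
  case (Cons t r)
  have t: "t < m" using assms Cons by (simp add: reduced_Cons)
  show ?thesis
  proof (cases "(t = 0) = (l = 0)")
    case False
    then show ?thesis using Cons by (auto simp: act_Cons eq_mod_centre_refl)
  next
    case True
    show ?thesis
    proof (cases "l = 0")
      case True
      then have "elt_of (l # w) = gz \<otimes>\<^bsub>G\<^esub> elt_of r" and "act l w = r"
        using Cons \<open>(t = 0) = (l = 0)\<close>
        by (simp_all add: elt_of_letter_def gz_def G.m_assoc act_Cons)
      then show ?thesis by (simp add: eq_mod_centre_gz_left)
    next
      case False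
      then have e: "elt_of (l # w) = gy [^]\<^bsub>G\<^esub> (l + t) \<otimes>\<^bsub>G\<^esub> elt_of r"
        using Cons True by (simp add: elt_of_letter_def G.nat_pow_mult flip: G.m_assoc)
      show ?thesis
      proof (cases "l + t < m")
        case True
        then have "elt_of (act l w) = gy [^]\<^bsub>G\<^esub> (l + t) \<otimes>\<^bsub>G\<^esub> elt_of r"
          using Cons False \<open>(t = 0) = (l = 0)\<close> by (simp add: act_Cons elt_of_letter_def)
        then show ?thesis using e by (simp add: eq_mod_centre_refl)
      next
        case ge: False
        define s where "s = l + t - m"
        have s: "l + t = m + s" "s < m" using ge assms t by (auto simp: s_def)
        then have mod: "(l + t) mod m = s" by simp
        have "elt_of (l # w) = gz \<otimes>\<^bsub>G\<^esub> (gy [^]\<^bsub>G\<^esub> s \<otimes>\<^bsub>G\<^esub> elt_of r)"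
          unfolding e s(1) gz_eq by (simp add: G.m_assoc flip: G.nat_pow_mult)
        also have "gy [^]\<^bsub>G\<^esub> s \<otimes>\<^bsub>G\<^esub> elt_of r = elt_of (act l w)"
          using Cons False \<open>(t = 0) = (l = 0)\<close> mod by (simp add: act_Cons elt_of_letter_def)
        finally show ?thesis by (simp add: eq_mod_centre_gz_left del: elt_of_simps)
      qed
    qed
  qed
qed

lemma eq_mod_centre_nf: "w \<in> words \<Longrightarrow> eq_mod_centre (elt_of w) (elt_of (nf w))"
proof (induction w)
  case (Cons l w)
  then have "eq_mod_centre (elt_of (l # w)) (elt_of (l # nf w))" by (simp add: eq_mod_centre_mult_left)
  moreover have "eq_mod_centre (elt_of (l # nf w)) (elt_of (nf (l # w)))"
    using Cons.prems eq_mod_centre_act[of "nf w" l] reduced_nf[of w] by (simp add: nf_def)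
  ultimately show ?case using eq_mod_centre_trans by (meson elt_of_carrier)
qed (simp add: eq_mod_centre_refl nf_def)

text \<open>In all four cases the word spells the letter times one factor \<open>z\<close>, because it replaces \<open>y\<^sup>-\<^sup>k\<close> by \<open>y\<close> to
  the power \<open>k + 1\<close>, or \<open>x\<close> inverse by \<open>x\<close>.\<close>

lemma eq_mod_centre_letter_word: "eq_mod_centre (elt_of (letter_word l)) (cls [l])"
proof -
  have km: "Suc k + k = m" "k + Suc k = m" using m_eq by simp_all
  have gz: "gy [^]\<^bsub>G\<^esub> Suc k \<otimes>\<^bsub>G\<^esub> gy [^]\<^bsub>G\<^esub> k = gz"
    "gy [^]\<^bsub>G\<^esub> k \<otimes>\<^bsub>G\<^esub> gy [^]\<^bsub>G\<^esub> Suc k = gz"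
    using G.nat_pow_mult[of gy "Suc k" k] G.nat_pow_mult[of gy k "Suc k"] km
    unfolding gz_eq by (simp_all only: gen_carrier)
  obtain x e where l: "l = (x, e)" by (cases l)
  have inv: "h = inv\<^bsub>G\<^esub> g \<otimes>\<^bsub>G\<^esub> gz" if "g \<otimes>\<^bsub>G\<^esub> h = gz" "g \<in> carrier G" "h \<in> carrier G" for g h
    using that(2,3) unfolding that(1)[symmetric] by (simp flip: G.m_assoc)
  show ?thesis
  proof (cases x)
    case GenA
    show ?thesis
    proof (cases e)
      case True
      have "elt_of (letter_word l) = gy [^]\<^bsub>G\<^esub> Suc k \<otimes>\<^bsub>G\<^esub> gx"
        using GenA True l by (simp add: letter_word_def elt_of_letter_def)
      also have "\<dots> = (gy [^]\<^bsub>G\<^esub> Suc k \<otimes>\<^bsub>G\<^esub> gy [^]\<^bsub>G\<^esub> k) \<otimes>\<^bsub>G\<^esub> ga"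
        unfolding gx_def by (simp add: G.m_assoc)
      finally show ?thesis using GenA True l unfolding gz by (simp add: eq_mod_centre_gz_left flip: ga_def)
    next
      case False
      have "ga \<otimes>\<^bsub>G\<^esub> (gx \<otimes>\<^bsub>G\<^esub> gy [^]\<^bsub>G\<^esub> k) = (gy \<otimes>\<^bsub>G\<^esub> gy [^]\<^bsub>G\<^esub> k) \<otimes>\<^bsub>G\<^esub> gy [^]\<^bsub>G\<^esub> k"
        unfolding gx_eq by (simp add: gy_def G.m_assoc)
      also have "gy \<otimes>\<^bsub>G\<^esub> gy [^]\<^bsub>G\<^esub> k = gy [^]\<^bsub>G\<^esub> Suc k"
        by (rule G.nat_pow_Suc2[symmetric]) simp
      finally have "gx \<otimes>\<^bsub>G\<^esub> gy [^]\<^bsub>G\<^esub> k = inv\<^bsub>G\<^esub> ga \<otimes>\<^bsub>G\<^esub> gz"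
        unfolding gz by (rule inv) simp_all
      then show ?thesis
        using GenA False l k_pos
        by (simp add: letter_word_def elt_of_letter_def cls_inv_letter eq_mod_centre_gz flip: ga_def)
    qed
  next
    case GenB
    show ?thesis
    proof (cases e)
      case True
      have "elt_of (letter_word l) = gx \<otimes>\<^bsub>G\<^esub> gy [^]\<^bsub>G\<^esub> Suc k"
        using GenB True l by (simp add: letter_word_def elt_of_letter_def)
      also have "\<dots> = gb \<otimes>\<^bsub>G\<^esub> (gy [^]\<^bsub>G\<^esub> k \<otimes>\<^bsub>G\<^esub> gy [^]\<^bsub>G\<^esub> Suc k)"
        unfolding gx_eq by (simp add: G.m_assoc)
      finally show ?thesis using GenB True l unfolding gz by (simp add: eq_mod_centre_gz flip: gb_def)
    next
      case False
      have "gb \<otimes>\<^bsub>G\<^esub> (gy [^]\<^bsub>G\<^esub> k \<otimes>\<^bsub>G\<^esub> gx) = gz"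
        using gx_eq by (simp add: gz_def flip: G.m_assoc)
      then have "gy [^]\<^bsub>G\<^esub> k \<otimes>\<^bsub>G\<^esub> gx = inv\<^bsub>G\<^esub> gb \<otimes>\<^bsub>G\<^esub> gz"
        by (rule inv) simp_all
      then show ?thesis
        using GenB False l k_pos
        by (simp add: letter_word_def elt_of_letter_def cls_inv_letter eq_mod_centre_gz flip: gb_def)
    qed
  qed
qed

lemma eq_mod_centre_elt_of_N:
  assumes "g \<in> carrier G"
  shows "eq_mod_centre g (elt_of (N g))"
proof -
  obtain u where u: "g = cls u" using assms by (auto simp: carrier_G)
  have "eq_mod_centre (elt_of (concat (map letter_word u))) (cls u)"
  proof (induction u)
    case (Cons l u)
    have "eq_mod_centre (elt_of (letter_word l) \<otimes>\<^bsub>G\<^esub> elt_of (concat (map letter_word u))) (elt_of (letter_word l) \<otimes>\<^bsub>G\<^esub> cls u)"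
      using Cons.IH by (simp add: eq_mod_centre_mult_left)
    moreover have "eq_mod_centre (elt_of (letter_word l) \<otimes>\<^bsub>G\<^esub> cls u) (cls [l] \<otimes>\<^bsub>G\<^esub> cls u)"
      by (simp add: eq_mod_centre_mult_right eq_mod_centre_letter_word)
    ultimately have "eq_mod_centre (elt_of (letter_word l) \<otimes>\<^bsub>G\<^esub> elt_of (concat (map letter_word u))) (cls [l] \<otimes>\<^bsub>G\<^esub> cls u)"
      using eq_mod_centre_trans by (meson G.m_closed cls_carrier)
    then show ?case by (simp add: elt_of_append cls_mult)
  qed (simp add: eq_mod_centre_refl flip: one_cls)
  then have "eq_mod_centre (cls u) (elt_of (concat (map letter_word u)))" by (rule eq_mod_centre_sym[rotated]) simp
  moreover have "eq_mod_centre (elt_of (concat (map letter_word u))) (elt_of (N g))"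
    using eq_mod_centre_nf[OF concat_letter_words] u by (simp add: N_cls gword_nf_def)
  ultimately show ?thesis using u eq_mod_centre_trans by (meson elt_of_carrier)
qed

lemma decompose:
  assumes "g \<in> carrier G"
  obtains n :: int where "g = elt_of (N g) \<otimes>\<^bsub>G\<^esub> gz [^]\<^bsub>G\<^esub> n"
  using eq_mod_centre_elt_of_N[OF assms] by (auto simp: eq_mod_centre_def)

lemma N_eq_Nil:
  assumes "g \<in> carrier G" "N g = []"
  obtains n :: int where "g = gz [^]\<^bsub>G\<^esub> n" "E g = 2 * int m * n"
proof -
  obtain n :: int where "g = elt_of (N g) \<otimes>\<^bsub>G\<^esub> gz [^]\<^bsub>G\<^esub> n" using decompose[OF assms(1)] .
  then have g: "g = gz [^]\<^bsub>G\<^esub> n" using assms(2) by simp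
  then have "E g = 2 * int m * n" by (simp add: E_int_pow)
  with g show ?thesis by (rule that)
qed

text \<open>The word \<open>N g\<close> determines \<open>g\<close> up to a power of \<open>z\<close>, and that power is read off from the exponent sum,
  as \<open>E z = 2 * m\<close> is not 0.\<close>

lemma eq_if_N_E_eq:
  assumes "g \<in> carrier G" "h \<in> carrier G" "N g = N h" "E g = E h"
  shows "g = h"
proof -
  let ?f = "inv\<^bsub>G\<^esub> g \<otimes>\<^bsub>G\<^esub> h"
  have "N ?f = N (inv\<^bsub>G\<^esub> g \<otimes>\<^bsub>G\<^esub> g)" using assms by (simp only: N_mult G.inv_closed)
  then have "N ?f = []" using assms(1) by simp
  then obtain n :: int where n: "?f = gz [^]\<^bsub>G\<^esub> n" "E ?f = 2 * int m * n"
    using N_eq_Nil assms by (metis G.inv_closed G.m_closed)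
  have "E ?f = 0" using assms by (simp add: E_mult E_inv)
  then have "n = 0" using n(2) m_pos by (auto simp del: m_pos)
  then have "?f = \<one>\<^bsub>G\<^esub>" using n(1) by simp
  then show ?thesis using assms(1,2) by (metis G.inv_closed G.inv_equality G.inv_inv)
qed

lemma N_mult3:
  assumes "f \<in> carrier G" "g \<in> carrier G" "h \<in> carrier G"
  shows "N (f \<otimes>\<^bsub>G\<^esub> g \<otimes>\<^bsub>G\<^esub> h) = nf (N f @ N g @ N h)"
  using assms nf_append_nf(1)[of "N f @ N g" "N h"] by (simp add: N_mult N_words)

lemma N_conj_elt_of:
  assumes "h \<in> carrier G" "s \<in> words"
  shows "N (inv\<^bsub>G\<^esub> (elt_of s) \<otimes>\<^bsub>G\<^esub> h \<otimes>\<^bsub>G\<^esub> elt_of s) = nf (inv_of s @ N h @ s)"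
proof -
  have hw: "N h \<in> words" using assms N_words by blast
  have "N (inv\<^bsub>G\<^esub> (elt_of s) \<otimes>\<^bsub>G\<^esub> h \<otimes>\<^bsub>G\<^esub> elt_of s) = nf ([] @ inv_of (nf s) @ (N h @ nf s))"
    using assms by (simp add: N_mult3 N_inv N_elt_of)
  also have "\<dots> = nf ([] @ inv_of s @ (N h @ nf s))"
    using assms hw nf_words[of s] by (intro nf_cong) (auto simp: nf_inv_of_nf)
  also have "\<dots> = nf ((inv_of s @ N h) @ nf s)" by simp
  also have "\<dots> = nf ((inv_of s @ N h) @ s)" using assms hw by (intro nf_append_nf(2)) auto
  finally show ?thesis by simp
qed

text \<open>If \<open>N g\<close> is a conjugate of \<open>N h\<close> by some word, then \<open>g\<close> and the conjugate of \<open>h\<close> by an element that spells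
  this word agree in \<open>N\<close>, and they agree in \<open>E\<close> because conjugation does not change it.\<close>

theorem conjugate_iff:
  assumes "g \<in> carrier G" "h \<in> carrier G"
  shows "conjugate_in G g h \<longleftrightarrow> E g = E h \<and> meets (N g) (N h)"
proof
  assume "conjugate_in G g h"
  then obtain t where t: "t \<in> carrier G" "g = t \<otimes>\<^bsub>G\<^esub> h \<otimes>\<^bsub>G\<^esub> inv\<^bsub>G\<^esub> t"
    by (auto simp: conjugate_in_def)
  have "N g = nf (inv_of (inv_of (N t)) @ N h @ inv_of (N t))"
    using t assms N_words[of t] by (simp add: N_mult3 N_inv)
  then have "meets (N g) (N h)"
    using meets_conj[of "inv_of (N t)" "N h"] N_reduced[OF assms(2)] by simp
  then show "E g = E h \<and> meets (N g) (N h)" using t assms by (simp add: E_mult E_inv)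
next
  assume *: "E g = E h \<and> meets (N g) (N h)"
  then obtain s where s: "s \<in> words" "N g = nf (inv_of s @ N h @ s)"
    using meets_imp_conj N_reduced assms by blast
  let ?t = "inv\<^bsub>G\<^esub> (elt_of s)"
  have "N (?t \<otimes>\<^bsub>G\<^esub> h \<otimes>\<^bsub>G\<^esub> inv\<^bsub>G\<^esub> ?t) = N g" using s assms by (simp add: N_conj_elt_of)
  moreover have "E (?t \<otimes>\<^bsub>G\<^esub> h \<otimes>\<^bsub>G\<^esub> inv\<^bsub>G\<^esub> ?t) = E g" using assms * by (simp add: E_mult E_inv)
  ultimately have "?t \<otimes>\<^bsub>G\<^esub> h \<otimes>\<^bsub>G\<^esub> inv\<^bsub>G\<^esub> ?t = g" using assms by (intro eq_if_N_E_eq) auto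
  then show "conjugate_in G g h"
    unfolding conjugate_in_def by (intro bexI[of _ ?t]) auto
qed

section \<open>Automorphisms\<close>

text \<open>This describes the kernel of \<open>N\<close> without reference to generators, so that it is seen to be
  preserved by automorphisms.\<close>

lemma central_iff:
  assumes g: "g \<in> carrier G"
  shows "N g = [] \<longleftrightarrow> (\<forall>h\<in>carrier G. g \<otimes>\<^bsub>G\<^esub> h = h \<otimes>\<^bsub>G\<^esub> g)"
proof
  assume "N g = []"
  then show "\<forall>h\<in>carrier G. g \<otimes>\<^bsub>G\<^esub> h = h \<otimes>\<^bsub>G\<^esub> g"
    using g by (intro ballI eq_if_N_E_eq) (simp_all add: N_mult E_mult)
next
  assume *: "\<forall>h\<in>carrier G. g \<otimes>\<^bsub>G\<^esub> h = h \<otimes>\<^bsub>G\<^esub> g"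
  have "nf (N g @ N h) = nf (N h @ N g)" if "h \<in> carrier G" for h
    using * that g N_mult by metis
  from this[of gx] this[of gy] show "N g = []"
    by (intro centre_trivial) (simp_all add: N_reduced g)
qed

text \<open>The reduced word fixes the exponent sum modulo \<open>2 * m\<close>.\<close>

lemma E_mod:
  assumes "g \<in> carrier G"
  obtains j :: int where "E g = E (elt_of (N g)) + 2 * int m * j"
proof -
  obtain n :: int where n: "g = elt_of (N g) \<otimes>\<^bsub>G\<^esub> gz [^]\<^bsub>G\<^esub> n" using decompose[OF assms] .
  have "E g = E (elt_of (N g) \<otimes>\<^bsub>G\<^esub> gz [^]\<^bsub>G\<^esub> n)" using n by simp
  also have "\<dots> = E (elt_of (N g)) + 2 * int m * n" by (simp add: E_mult E_int_pow)
  finally show ?thesis by (rule that)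
qed

text \<open>Up to conjugacy \<open>N u\<close> is cyclically reduced. If it had two or more letters, then the powers of it
  would be reduced words as well, so that none of them could be trivial.\<close>

lemma finite_order_conj:
  assumes u: "u \<in> carrier G" and fin: "N (u [^]\<^bsub>G\<^esub> Suc n) = []"
  obtains t where "t \<in> carrier G" "length (N (inv\<^bsub>G\<^esub> t \<otimes>\<^bsub>G\<^esub> u \<otimes>\<^bsub>G\<^esub> t)) \<le> 1"
proof -
  let ?c = "(rot ^^ length (N u)) (N u)"
  obtain g where g: "g \<in> words" "?c = nf (inv_of g @ N u @ g)"
    using rot_funpow_conj[OF N_reduced[OF u]] by blast
  let ?t = "elt_of g"
  let ?v = "inv\<^bsub>G\<^esub> ?t \<otimes>\<^bsub>G\<^esub> u \<otimes>\<^bsub>G\<^esub> ?t"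
  have v: "?v \<in> carrier G" using u by simp
  have Nv: "N ?v = ?c" using g N_conj_elt_of[OF u g(1)] by simp
  have cyc: "cyc_reduced (N ?v)" unfolding Nv by (rule cyc_reduced_rot_funpow[OF N_reduced[OF u]]) simp
  have "length (N ?v) \<le> 1"
  proof (rule ccontr)
    assume long: "\<not> length (N ?v) \<le> 1"
    then have cc: "reduced (N ?v @ N ?v)" and ne: "N ?v \<noteq> []" using cyc by (auto simp: cyc_reduced_def)
    have pow: "N (?v [^]\<^bsub>G\<^esub> Suc j) = concat (replicate (Suc j) (N ?v)) \<and>
        reduced (concat (replicate (Suc j) (N ?v))) \<and> hd (concat (replicate (Suc j) (N ?v))) = hd (N ?v)" for j
    proof (induction j)
      case 0
      show ?case using v N_reduced by simp
    next
      case (Suc j)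
      let ?p = "concat (replicate (Suc j) (N ?v))"
      have "reduced (N ?v @ ?p)" using Suc.IH cc ne by (auto simp: reduced_append)
      moreover have "N (?v [^]\<^bsub>G\<^esub> Suc (Suc j)) = nf (N ?v @ ?p)"
        using G.nat_pow_Suc2[OF v, of "Suc j"] Suc.IH v by (simp only: N_mult G.nat_pow_closed)
      ultimately show ?case using nf_reduced[of "N ?v @ ?p"] ne by simp
    qed
    have "N (?v [^]\<^bsub>G\<^esub> Suc n) = N (inv\<^bsub>G\<^esub> ?t \<otimes>\<^bsub>G\<^esub> (u [^]\<^bsub>G\<^esub> Suc n) \<otimes>\<^bsub>G\<^esub> ?t)"
      using G.conj_nat_pow[OF elt_of_carrier u] by metis
    also have "\<dots> = nf (N (inv\<^bsub>G\<^esub> ?t) @ [] @ N ?t)"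
      using N_mult3[of "inv\<^bsub>G\<^esub> ?t" "u [^]\<^bsub>G\<^esub> Suc n" ?t] fin u by (simp only: G.inv_closed G.nat_pow_closed elt_of_carrier)
    also have "\<dots> = N (inv\<^bsub>G\<^esub> ?t \<otimes>\<^bsub>G\<^esub> ?t)" by (simp only: N_mult G.inv_closed elt_of_carrier append_Nil)
    also have "\<dots> = []" by simp
    finally show False using pow[of n] ne by simp
  qed
  then show ?thesis by (rule that[OF elt_of_carrier])
qed

lemma E_conj: "t \<in> carrier G \<Longrightarrow> g \<in> carrier G \<Longrightarrow> E (inv\<^bsub>G\<^esub> t \<otimes>\<^bsub>G\<^esub> g \<otimes>\<^bsub>G\<^esub> t) = E g"
  by (simp add: E_mult E_inv)

lemma conj_back:
  assumes "t \<in> carrier G" "g \<in> carrier G" "inv\<^bsub>G\<^esub> t \<otimes>\<^bsub>G\<^esub> g \<otimes>\<^bsub>G\<^esub> t = h"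
  shows "g = t \<otimes>\<^bsub>G\<^esub> h \<otimes>\<^bsub>G\<^esub> inv\<^bsub>G\<^esub> t"
  using assms(1,2) unfolding assms(3)[symmetric] by (simp add: G.m_assoc G.inv_cancel_left)

end

locale artin_automorphism = odd_dihedral_artin +
  fixes \<phi> :: "dgen gword set \<Rightarrow> dgen gword set"
  assumes aut: "\<phi> \<in> auto G"
begin

sublocale \<phi>: group_hom G G \<phi>
  using aut by unfold_locales (simp add: auto_def)

lemma phi_surj:
  assumes "h \<in> carrier G"
  obtains g where "g \<in> carrier G" "\<phi> g = h"
proof -
  have "\<phi> ` carrier G = carrier G" using aut by (simp add: auto_def Bij_def bij_betw_def)
  then show ?thesis using assms that by (metis imageE)
qed

lemma phi_inj: "g \<in> carrier G \<Longrightarrow> h \<in> carrier G \<Longrightarrow> \<phi> g = \<phi> h \<Longrightarrow> g = h"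
  using aut by (auto simp: auto_def Bij_def bij_betw_def inj_on_def)

lemma N_phi_Nil:
  assumes g: "g \<in> carrier G"
  shows "N (\<phi> g) = [] \<longleftrightarrow> N g = []"
proof -
  have *: "\<phi> g \<otimes>\<^bsub>G\<^esub> \<phi> h = \<phi> h \<otimes>\<^bsub>G\<^esub> \<phi> g \<longleftrightarrow> g \<otimes>\<^bsub>G\<^esub> h = h \<otimes>\<^bsub>G\<^esub> g" if "h \<in> carrier G" for h
    using that g phi_inj[of "g \<otimes>\<^bsub>G\<^esub> h" "h \<otimes>\<^bsub>G\<^esub> g"] by (auto simp flip: \<phi>.hom_mult)
  then show ?thesis
    unfolding central_iff[OF g] central_iff[OF \<phi>.hom_closed[OF g]] by (metis phi_surj \<phi>.hom_closed)
qed

text \<open>The centre is infinite cyclic, and \<open>\<phi>\<close> restricts to an automorphism of it, so it sends the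
  generator \<open>z\<close> to a generator.\<close>

lemma phi_gz: obtains n :: int where "n = 1 \<or> n = -1" "\<phi> gz = gz [^]\<^bsub>G\<^esub> n"
proof -
  obtain n :: int where n: "\<phi> gz = gz [^]\<^bsub>G\<^esub> n"
    using N_phi_Nil[of gz] N_eq_Nil[of "\<phi> gz"] by auto
  obtain g where g: "g \<in> carrier G" "\<phi> g = gz" using phi_surj[of gz] by auto
  then have "N g = []" using N_phi_Nil[of g] by simp
  then obtain n' :: int where n': "g = gz [^]\<^bsub>G\<^esub> n'" using N_eq_Nil g(1) by blast
  have "gz = (gz [^]\<^bsub>G\<^esub> n) [^]\<^bsub>G\<^esub> n'" using g n n' by (simp add: \<phi>.hom_int_pow)
  then have "E gz = E (gz [^]\<^bsub>G\<^esub> (n * n'))" by (simp add: G.int_pow_pow)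
  then have "2 * int m * (n * n') = 2 * int m" by (simp add: E_int_pow)
  then have "n * n' = 1" using m_pos by (auto simp del: m_pos)
  then have "n = 1 \<or> n = -1" by (auto simp: zmult_eq_1_iff)
  then show ?thesis using n that by blast
qed

text \<open>Modulo the centre, the images of \<open>x\<close> and \<open>y\<close> are conjugate to words of length at most 1. The equations
  \<open>\<phi> x\<^sup>2 = \<phi> y\<^sup>m = z\<^sup>n\<close> give their exponent sums as \<open>m * n\<close> and \<open>2 * n\<close>. Since an odd exponent sum goes with
  the letter \<open>x\<close> and an even one with the empty word or a power of \<open>y\<close>, the parity, and for \<open>\<phi> y\<close> the residue
  modulo \<open>2 * m\<close>, single out the letters of \<open>x\<^sup>n\<close> and \<open>y\<^sup>n\<close>.\<close>

lemma phi_generators: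
  obtains n :: int and t h where "n = 1 \<or> n = -1" "\<phi> gz = gz [^]\<^bsub>G\<^esub> n"
    "t \<in> carrier G" "h \<in> carrier G"
    "\<phi> gx = t \<otimes>\<^bsub>G\<^esub> gx [^]\<^bsub>G\<^esub> n \<otimes>\<^bsub>G\<^esub> inv\<^bsub>G\<^esub> t"
    "\<phi> gy = (t \<otimes>\<^bsub>G\<^esub> h) \<otimes>\<^bsub>G\<^esub> gy [^]\<^bsub>G\<^esub> n \<otimes>\<^bsub>G\<^esub> inv\<^bsub>G\<^esub> (t \<otimes>\<^bsub>G\<^esub> h)"
proof -
  obtain n :: int where n: "n = 1 \<or> n = -1" "\<phi> gz = gz [^]\<^bsub>G\<^esub> n" by (rule phi_gz)
  have Egz: "E (\<phi> gz) = 2 * int m * n" and Ngz: "N (\<phi> gz) = []"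
    using n N_phi_Nil[of gz] by (simp_all add: E_int_pow)
  have odd: "odd (int m)" and m3: "3 \<le> int m" using m_eq k_pos by auto
  have letter_E: "E (elt_of [l]) = (if l = 0 then int m else 2 * int l)" for l
    by (simp add: elt_of_letter_def E_nat_pow)
  have xpow: "\<phi> gx [^]\<^bsub>G\<^esub> Suc 1 = \<phi> gz" by (simp add: gz_def \<phi>.hom_mult)
  have ypow: "\<phi> gy [^]\<^bsub>G\<^esub> m = \<phi> gz" by (simp add: gz_eq \<phi>.hom_nat_pow)
  have fin: "N (\<phi> gx [^]\<^bsub>G\<^esub> Suc 1) = []" "N (\<phi> gy [^]\<^bsub>G\<^esub> Suc (2 * k)) = []"
    unfolding m_eq[symmetric] by (simp_all only: xpow ypow Ngz)
  have Ex: "E (\<phi> gx) = int m * n"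
    using E_nat_pow[of "\<phi> gx" "Suc 1"] xpow Egz by simp
  have "int m * E (\<phi> gy) = int m * (2 * n)"
    using E_nat_pow[of "\<phi> gy" m] ypow Egz by auto
  then have Ey: "E (\<phi> gy) = 2 * n" using m3 by auto
  obtain t where t: "t \<in> carrier G" "length (N (inv\<^bsub>G\<^esub> t \<otimes>\<^bsub>G\<^esub> \<phi> gx \<otimes>\<^bsub>G\<^esub> t)) \<le> 1"
    by (rule finite_order_conj[OF _ fin(1)]) simp_all
  obtain s where s: "s \<in> carrier G" "length (N (inv\<^bsub>G\<^esub> s \<otimes>\<^bsub>G\<^esub> \<phi> gy \<otimes>\<^bsub>G\<^esub> s)) \<le> 1"
    by (rule finite_order_conj[OF _ fin(2)]) simp_all
  let ?x = "inv\<^bsub>G\<^esub> t \<otimes>\<^bsub>G\<^esub> \<phi> gx \<otimes>\<^bsub>G\<^esub> t"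
  let ?y = "inv\<^bsub>G\<^esub> s \<otimes>\<^bsub>G\<^esub> \<phi> gy \<otimes>\<^bsub>G\<^esub> s"
  have xy: "?x \<in> carrier G" "?y \<in> carrier G" "E ?x = int m * n" "E ?y = 2 * n"
    using t s Ex Ey by (simp_all add: E_conj)
  have short: "N g = [] \<or> (\<exists>l<m. N g = [l])" if "g \<in> carrier G" "length (N g) \<le> 1" for g
    using that N_reduced[of g] by (cases "N g") auto
  obtain jx where jx: "E ?x = E (elt_of (N ?x)) + 2 * int m * jx" using E_mod[OF xy(1)] .
  obtain jy where jy: "E ?y = E (elt_of (N ?y)) + 2 * int m * jy" using E_mod[OF xy(2)] .
  have oddx: "odd (E ?x)" unfolding xy(3) using n odd by auto
  have Nx: "N ?x = [0]"
  proof -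
    have oddev: "odd (E (elt_of (N ?x)))" using oddx jx by simp
    consider "N ?x = []" | l where "N ?x = [l]" using short[OF xy(1)] t by blast
    then show ?thesis
    proof cases
      case 1
      then have "E (elt_of (N ?x)) = 0" by simp
      then show ?thesis using oddev by simp
    next
      case (2 l)
      then have "E (elt_of (N ?x)) = (if l = 0 then int m else 2 * int l)" using letter_E[of l] by simp
      then have "l = 0" using oddev by (simp split: if_splits)
      then show ?thesis using 2 by simp
    qed
  qed
  have Nxp: "N (gx [^]\<^bsub>G\<^esub> n) = [0]" and Nyp: "N (gy [^]\<^bsub>G\<^esub> n) = (if n = 1 then [1] else [neg 1])"
    using n(1) by (auto simp: G.int_pow_neg N_inv)
  have x: "?x = gx [^]\<^bsub>G\<^esub> n"
    using xy Nx Nxp by (intro eq_if_N_E_eq) (simp_all add: E_int_pow)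
  have Ny: "N ?y = N (gy [^]\<^bsub>G\<^esub> n)"
  proof -
    have ev_y: "E (elt_of (N ?y)) = 2 * (n - int m * jy)" using jy xy(4) by (simp add: algebra_simps)
    consider "N ?y = []" | l where "N ?y = [l]" "l < m" using short[OF xy(2)] s by blast
    then show ?thesis
    proof cases
      case 1
      then have "int m dvd n" using ev_y by simp
      then have "int m dvd 1" using n(1) by auto
      then show ?thesis using m3 by simp
    next
      case 2
      have l_eq: "(if l = 0 then int m else 2 * int l) = 2 * (n - int m * jy)"
        using ev_y letter_E[of l] unfolding 2 by simp
      then have "even (if l = 0 then int m else 2 * int l)" by simp
      then have "l \<noteq> 0" using odd by (simp split: if_splits)
      then have "int l = n - int m * jy" using l_eq by simp
      then have "int l mod int m = n mod int m" by (simp add: mod_diff_eq[symmetric])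
      then have l: "int l = n mod int m" using 2 by simp
      show ?thesis
      proof (cases "n = 1")
        case True
        then show ?thesis using l m3 2 Nyp by simp
      next
        case False
        then have "n = -1" using n by simp
        then have "int l = int m - 1" using l m3 by (simp add: zmod_minus1)
        then have "l = neg 1" using m3 by (simp add: neg_def)
        then show ?thesis using 2 Nyp False by simp
      qed
    qed
  qed
  have y: "?y = gy [^]\<^bsub>G\<^esub> n"
    using xy Ny by (intro eq_if_N_E_eq) (simp_all add: E_int_pow)
  have "t \<otimes>\<^bsub>G\<^esub> (inv\<^bsub>G\<^esub> t \<otimes>\<^bsub>G\<^esub> s) = s" using t s by (simp flip: G.m_assoc)
  then show ?thesis
    using that[OF n t(1), of "inv\<^bsub>G\<^esub> t \<otimes>\<^bsub>G\<^esub> s"] conj_back[OF t(1) _ x] conj_back[OF s(1) _ y] t s by simp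
qed

text \<open>The element \<open>h\<close> is the discrepancy between the elements that conjugate \<open>x\<^sup>n\<close> and \<open>y\<^sup>n\<close> into their
  images.\<close>

definition normalised :: "int \<Rightarrow> dgen gword set \<Rightarrow> dgen gword set \<Rightarrow> bool" where
  "normalised n t h \<longleftrightarrow> t \<in> carrier G \<and> h \<in> carrier G \<and>
    \<phi> gx = t \<otimes>\<^bsub>G\<^esub> gx [^]\<^bsub>G\<^esub> n \<otimes>\<^bsub>G\<^esub> inv\<^bsub>G\<^esub> t \<and>
    \<phi> gy = (t \<otimes>\<^bsub>G\<^esub> h) \<otimes>\<^bsub>G\<^esub> gy [^]\<^bsub>G\<^esub> n \<otimes>\<^bsub>G\<^esub> inv\<^bsub>G\<^esub> (t \<otimes>\<^bsub>G\<^esub> h)"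

lemma pow_commute:
  assumes "g \<in> carrier G"
  shows "g [^]\<^bsub>G\<^esub> (i::int) \<otimes>\<^bsub>G\<^esub> g [^]\<^bsub>G\<^esub> (j::int) = g [^]\<^bsub>G\<^esub> j \<otimes>\<^bsub>G\<^esub> g [^]\<^bsub>G\<^esub> i"
  using assms by (simp add: add.commute flip: G.int_pow_mult)

text \<open>Choose \<open>h\<close> with \<open>N h\<close> as short as possible. A leading \<open>x\<close> could be moved from \<open>h\<close> to \<open>t\<close>, since it commutes
  with \<open>x\<^sup>n\<close>, and a trailing power of \<open>y\<close> could be dropped, since it commutes with \<open>y\<^sup>n\<close>.\<close>

lemma normalised_minimal:
  assumes "normalised n t h"
  obtains t' h' where "normalised n t' h'"
    "N h' = [] \<or> (hd (N h') \<noteq> 0 \<and> last (N h') = 0)"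
proof -
  have "\<exists>p. normalised n (fst p) (snd p)" using assms by auto
  then obtain p where p: "normalised n (fst p) (snd p)"
    and min: "\<And>q. normalised n (fst q) (snd q) \<Longrightarrow> length (N (snd p)) \<le> length (N (snd q))"
    using ex_has_least_nat[of "\<lambda>p. normalised n (fst p) (snd p)" _ "\<lambda>p. length (N (snd p))"] by metis
  let ?t = "fst p" and ?h = "snd p"
  note nt = p[unfolded normalised_def]
  have h: "reduced (N ?h)" using nt N_reduced by blast
  show ?thesis
  proof (rule that[OF p], rule ccontr)
    assume *: "\<not> (N ?h = [] \<or> (hd (N ?h) \<noteq> 0 \<and> last (N ?h) = 0))"
    show False
    proof (cases "hd (N ?h) = 0")
      case True
      then obtain r where r: "N ?h = 0 # r" using * by (cases "N ?h") auto
      let ?t' = "?t \<otimes>\<^bsub>G\<^esub> gx" and ?h' = "inv\<^bsub>G\<^esub> gx \<otimes>\<^bsub>G\<^esub> ?h"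
      have "?t' \<otimes>\<^bsub>G\<^esub> ?h' = ?t \<otimes>\<^bsub>G\<^esub> ?h" using nt by (simp add: G.m_assoc G.inv_cancel_left)
      moreover have "gx \<otimes>\<^bsub>G\<^esub> gx [^]\<^bsub>G\<^esub> n = gx [^]\<^bsub>G\<^esub> n \<otimes>\<^bsub>G\<^esub> gx" using pow_commute[of gx 1 n] by simp
      then have "?t' \<otimes>\<^bsub>G\<^esub> gx [^]\<^bsub>G\<^esub> n \<otimes>\<^bsub>G\<^esub> inv\<^bsub>G\<^esub> ?t' = ?t \<otimes>\<^bsub>G\<^esub> gx [^]\<^bsub>G\<^esub> n \<otimes>\<^bsub>G\<^esub> inv\<^bsub>G\<^esub> ?t"
        using nt by (intro G.conj_absorb) simp_all
      ultimately have "normalised n ?t' ?h'" using nt unfolding normalised_def by simp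
      from min[of "(?t', ?h')"] this have "length (N ?h) \<le> length (N ?h')" by simp
      moreover have "N ?h' = r"
        using nt h r nf_cancel_middle(1)[of 0 "[]" r] nf_reduced[of r]
        by (simp add: N_mult N_inv reduced_Cons reduced_words)
      ultimately show False using r by simp
    next
      case False
      then have ne: "N ?h \<noteq> []" and last: "last (N ?h) \<noteq> 0" using * by auto
      then obtain s l where s: "N ?h = s @ [l]" "l \<noteq> 0" by (cases "N ?h" rule: rev_cases) auto
      then have l: "l < m" and sr: "reduced s" using h by (auto simp: reduced_append)
      let ?c = "inv\<^bsub>G\<^esub> (gy [^]\<^bsub>G\<^esub> l)"
      let ?h' = "?h \<otimes>\<^bsub>G\<^esub> ?c"
      have c: "?c = gy [^]\<^bsub>G\<^esub> (- int l)" by (simp add: G.int_pow_neg int_pow_int)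
      have "?c \<otimes>\<^bsub>G\<^esub> gy [^]\<^bsub>G\<^esub> n = gy [^]\<^bsub>G\<^esub> n \<otimes>\<^bsub>G\<^esub> ?c" unfolding c by (rule pow_commute) simp
      then have "((?t \<otimes>\<^bsub>G\<^esub> ?h) \<otimes>\<^bsub>G\<^esub> ?c) \<otimes>\<^bsub>G\<^esub> gy [^]\<^bsub>G\<^esub> n \<otimes>\<^bsub>G\<^esub> inv\<^bsub>G\<^esub> ((?t \<otimes>\<^bsub>G\<^esub> ?h) \<otimes>\<^bsub>G\<^esub> ?c) =
          (?t \<otimes>\<^bsub>G\<^esub> ?h) \<otimes>\<^bsub>G\<^esub> gy [^]\<^bsub>G\<^esub> n \<otimes>\<^bsub>G\<^esub> inv\<^bsub>G\<^esub> (?t \<otimes>\<^bsub>G\<^esub> ?h)"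
        using nt by (intro G.conj_absorb) simp_all
      moreover have "?t \<otimes>\<^bsub>G\<^esub> ?h' = (?t \<otimes>\<^bsub>G\<^esub> ?h) \<otimes>\<^bsub>G\<^esub> ?c" using nt by (simp add: G.m_assoc)
      ultimately have "normalised n ?t ?h'" using nt unfolding normalised_def by (simp del: G.inv_mult_group)
      from min[of "(?t, ?h')"] this have "length (N ?h) \<le> length (N ?h')" by simp
      moreover have "N ?h' = s"
        using nt s l sr nf_cancel_middle(1)[of l s "[]"] nf_reduced[of s]
        by (simp add: N_mult N_inv N_gy_pow reduced_words)
      ultimately show False using s by simp
    qed
  qed
qed

text \<open>Followed by conjugation with \<open>t\<close>, the automorphism fixes \<open>x\<close> and sends \<open>y\<close> to the conjugate of \<open>y\<^sup>n\<close> by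
  \<open>h\<close>, as seen in the free product. So it acts on words by substitution.\<close>

lemma N_conj_phi_elt_of:
  assumes n: "normalised n t h" "n = 1 \<or> n = -1" and w: "w \<in> words"
  shows "N (inv\<^bsub>G\<^esub> t \<otimes>\<^bsub>G\<^esub> \<phi> (elt_of w) \<otimes>\<^bsub>G\<^esub> t) =
    nf (concat (map (sandwich (if n = 1 then id else neg) (N h)) w))"
  using w
proof (induction w rule: list.induct)
  case Nil
  show ?case using n by (simp add: normalised_def nf_def)
next
  case (Cons l w)
  let ?\<nu> = "if n = 1 then id else neg"
  have t: "t \<in> carrier G" "h \<in> carrier G" and l: "l < m" and w: "w \<in> words"
    using n Cons.prems by (auto simp: normalised_def)
  have sw: "sandwich ?\<nu> (N h) i \<in> words" if "i < m" for i
    using that N_words[OF t(2)] by (auto simp: sandwich_def)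
  then have cw: "concat (map (sandwich ?\<nu> (N h)) w) \<in> words"
    using w by (induction w rule: list.induct) auto
  have letter: "N (inv\<^bsub>G\<^esub> t \<otimes>\<^bsub>G\<^esub> \<phi> (elt_of_letter l) \<otimes>\<^bsub>G\<^esub> t) = nf (sandwich ?\<nu> (N h) l)"
  proof (cases "l = 0")
    case True
    have "inv\<^bsub>G\<^esub> t \<otimes>\<^bsub>G\<^esub> \<phi> gx \<otimes>\<^bsub>G\<^esub> t = gx [^]\<^bsub>G\<^esub> n"
      using n(1) by (simp add: normalised_def G.m_assoc G.inv_cancel_left)
    moreover have "N (gx [^]\<^bsub>G\<^esub> n) = [0]" using n(2) by (auto simp: G.int_pow_neg N_inv)
    ultimately show ?thesis using True by (simp add: elt_of_letter_def sandwich_def nf_def)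
  next
    case False
    have "inv\<^bsub>G\<^esub> t \<otimes>\<^bsub>G\<^esub> \<phi> gy \<otimes>\<^bsub>G\<^esub> t = inv\<^bsub>G\<^esub> (inv\<^bsub>G\<^esub> h) \<otimes>\<^bsub>G\<^esub> gy [^]\<^bsub>G\<^esub> n \<otimes>\<^bsub>G\<^esub> inv\<^bsub>G\<^esub> h"
      using n(1) by (simp add: normalised_def G.m_assoc G.inv_cancel_left G.inv_mult_group)
    then have "inv\<^bsub>G\<^esub> t \<otimes>\<^bsub>G\<^esub> \<phi> (gy [^]\<^bsub>G\<^esub> l) \<otimes>\<^bsub>G\<^esub> t =
        inv\<^bsub>G\<^esub> (inv\<^bsub>G\<^esub> h) \<otimes>\<^bsub>G\<^esub> (gy [^]\<^bsub>G\<^esub> n) [^]\<^bsub>G\<^esub> l \<otimes>\<^bsub>G\<^esub> inv\<^bsub>G\<^esub> h"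
      using t by (simp only: \<phi>.hom_nat_pow gen_carrier G.conj_nat_pow \<phi>.hom_closed G.inv_closed G.int_pow_closed)
    moreover have "N ((gy [^]\<^bsub>G\<^esub> n) [^]\<^bsub>G\<^esub> l) = [?\<nu> l]"
      using n(2) l False by (auto simp: G.int_pow_neg N_inv N_gy_pow G.nat_pow_inv)
    ultimately show ?thesis using t False by (simp add: elt_of_letter_def sandwich_def N_mult3 N_inv)
  qed
  have "inv\<^bsub>G\<^esub> t \<otimes>\<^bsub>G\<^esub> \<phi> (elt_of (l # w)) \<otimes>\<^bsub>G\<^esub> t =
      (inv\<^bsub>G\<^esub> t \<otimes>\<^bsub>G\<^esub> \<phi> (elt_of_letter l) \<otimes>\<^bsub>G\<^esub> t) \<otimes>\<^bsub>G\<^esub> (inv\<^bsub>G\<^esub> t \<otimes>\<^bsub>G\<^esub> \<phi> (elt_of w) \<otimes>\<^bsub>G\<^esub> t)"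
    using t by (simp add: G.conj_mult)
  then have "N (inv\<^bsub>G\<^esub> t \<otimes>\<^bsub>G\<^esub> \<phi> (elt_of (l # w)) \<otimes>\<^bsub>G\<^esub> t) =
      nf (nf (sandwich ?\<nu> (N h) l) @ nf (concat (map (sandwich ?\<nu> (N h)) w)))"
    using t letter Cons.IH[OF w] by (simp add: N_mult)
  also have "\<dots> = nf (sandwich ?\<nu> (N h) l @ concat (map (sandwich ?\<nu> (N h)) w))"
    using nf_append_nf(1)[OF sw[OF l] nf_words[OF cw]] nf_append_nf(2)[OF sw[OF l] cw] by simp
  finally show ?case by simp
qed

lemma N_conj_phi:
  assumes n: "normalised n t h" "n = 1 \<or> n = -1" and u: "u \<in> carrier G"
  shows "N (inv\<^bsub>G\<^esub> t \<otimes>\<^bsub>G\<^esub> \<phi> u \<otimes>\<^bsub>G\<^esub> t) =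
    nf (concat (map (sandwich (if n = 1 then id else neg) (N h)) (N u)))"
proof -
  obtain j :: int where j: "u = elt_of (N u) \<otimes>\<^bsub>G\<^esub> gz [^]\<^bsub>G\<^esub> j" using decompose[OF u] .
  have t: "t \<in> carrier G" using n by (simp add: normalised_def)
  have "N (gz [^]\<^bsub>G\<^esub> j) = []" using gz_pow_commute by (subst central_iff) auto
  then have c: "N (\<phi> (gz [^]\<^bsub>G\<^esub> j)) = []" by (subst N_phi_Nil) simp_all
  have "N (inv\<^bsub>G\<^esub> t \<otimes>\<^bsub>G\<^esub> \<phi> u \<otimes>\<^bsub>G\<^esub> t) =
      N (inv\<^bsub>G\<^esub> t \<otimes>\<^bsub>G\<^esub> (\<phi> (elt_of (N u)) \<otimes>\<^bsub>G\<^esub> \<phi> (gz [^]\<^bsub>G\<^esub> j)) \<otimes>\<^bsub>G\<^esub> t)"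
    by (subst j) (simp only: \<phi>.hom_mult elt_of_carrier G.int_pow_closed gen_carrier)
  also have "\<dots> = N (inv\<^bsub>G\<^esub> t \<otimes>\<^bsub>G\<^esub> \<phi> (elt_of (N u)) \<otimes>\<^bsub>G\<^esub> t)"
    using t c by (simp add: N_mult3 N_mult N_reduced nf_reduced del: \<phi>.hom_int_pow)
  finally show ?thesis using N_conj_phi_elt_of[OF n N_words[OF u]] by simp
qed

text \<open>Some element is sent to the conjugate of \<open>y\<close> by \<open>t\<close>. If \<open>h\<close> were not trivial, substitution would cause no
  cancellation in the reduced word of this element, and the result would be a word in \<open>x\<close> alone or
  have more than one letter; it could not be \<open>y\<close>.\<close>

lemma normalised_trivial:
  assumes n: "normalised n t h" "n = 1 \<or> n = -1"
    and h: "N h = [] \<or> (hd (N h) \<noteq> 0 \<and> last (N h) = 0)"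
  shows "N h = []"
proof (rule ccontr)
  assume ne: "N h \<noteq> []"
  let ?S = "sandwich (if n = 1 then id else neg) (N h)"
  have t: "t \<in> carrier G" "h \<in> carrier G" using n by (simp_all add: normalised_def)
  obtain u where u: "u \<in> carrier G" "\<phi> u = t \<otimes>\<^bsub>G\<^esub> gy \<otimes>\<^bsub>G\<^esub> inv\<^bsub>G\<^esub> t"
    using phi_surj[of "t \<otimes>\<^bsub>G\<^esub> gy \<otimes>\<^bsub>G\<^esub> inv\<^bsub>G\<^esub> t"] t by auto
  have "inv\<^bsub>G\<^esub> t \<otimes>\<^bsub>G\<^esub> \<phi> u \<otimes>\<^bsub>G\<^esub> t = gy" using t u(2) by (simp add: G.m_assoc G.inv_cancel_left)
  then have "nf (concat (map ?S (N u))) = [1]" using N_conj_phi[OF n u(1)] by simp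
  moreover have "reduced (concat (map ?S (N u)))"
    using reduced_concat_sandwich[OF N_reduced[OF t(2)] ne _ _ _ _ N_reduced[OF u(1)],
        of "if n = 1 then id else neg"] h ne by simp
  ultimately have eq: "concat (map ?S (N u)) = [1]" using nf_reduced by simp
  then have "1 \<in> set (concat (map ?S (N u)))" by simp
  then obtain l where l: "l \<in> set (N u)" "1 \<in> set (?S l)" by auto
  then have "l \<noteq> 0" by (cases "l = 0") (auto simp: sandwich_def)
  then have "1 < length (?S l)" using ne by (simp add: sandwich_def)
  also have "length (?S l) \<le> length (concat (map ?S (N u)))"
    using l(1) by (auto simp: length_concat intro!: member_le_sum_list)
  finally show False using eq by simp
qed

text \<open>Up to conjugation by \<open>t\<close>, the automorphism \<open>\<phi>\<close> replaces \<open>x\<close> and \<open>y\<close> by \<open>x\<^sup>n\<close> and \<open>y\<^sup>n\<close>. For \<open>n = -1\<close> this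
  turns every letter of the reduced word into its inverse, in place, and changes the sign of \<open>E\<close>.\<close>

theorem automorphism_cases:
  "(\<forall>u\<in>carrier G. E (\<phi> u) = E u \<and> meets (N (\<phi> u)) (N u)) \<or>
   (\<forall>u\<in>carrier G. E (\<phi> u) = - E u \<and> meets (N (\<phi> u)) (map neg (N u)))"
proof -
  obtain n :: int and t0 h0 where n: "n = 1 \<or> n = -1" "\<phi> gz = gz [^]\<^bsub>G\<^esub> n" "normalised n t0 h0"
    using phi_generators unfolding normalised_def by metis
  obtain t h where th: "normalised n t h" "N h = []"
    using normalised_minimal[OF n(3)] normalised_trivial n(1) by metis
  let ?\<nu> = "if n = 1 then id else neg"
  have t: "t \<in> carrier G" "h \<in> carrier G" using th by (simp_all add: normalised_def)
  have Egen: "E (\<phi> gx) = n * E gx" "E (\<phi> gy) = n * E gy"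
    using th by (simp_all add: normalised_def E_mult E_inv E_int_pow)
  have E_elt_of: "E (\<phi> (elt_of w)) = n * E (elt_of w)" for w
    by (induction w) (auto simp: E_mult elt_of_letter_def \<phi>.hom_nat_pow E_nat_pow Egen algebra_simps
        simp del: E_gx E_gy)
  have E_central: "E (\<phi> (gz [^]\<^bsub>G\<^esub> (j::int))) = n * E (gz [^]\<^bsub>G\<^esub> j)" for j
    by (simp add: \<phi>.hom_int_pow n(2) E_int_pow)
  have E: "E (\<phi> u) = n * E u" if u: "u \<in> carrier G" for u
  proof -
    obtain j :: int where j: "u = elt_of (N u) \<otimes>\<^bsub>G\<^esub> gz [^]\<^bsub>G\<^esub> j" using decompose[OF u] .
    have "E (\<phi> u) = E (\<phi> (elt_of (N u))) + E (\<phi> (gz [^]\<^bsub>G\<^esub> j))"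
      by (subst j) (simp only: \<phi>.hom_mult E_mult \<phi>.hom_closed elt_of_carrier G.int_pow_closed gen_carrier)
    also have "\<dots> = n * (E (elt_of (N u)) + E (gz [^]\<^bsub>G\<^esub> j))"
      using E_elt_of E_central by (simp only: distrib_left)
    also have "E (elt_of (N u)) + E (gz [^]\<^bsub>G\<^esub> j) = E u"
      by (subst (2) j) (simp only: E_mult elt_of_carrier G.int_pow_closed gen_carrier)
    finally show ?thesis .
  qed
  have sandwich: "concat (map (sandwich ?\<nu> []) w) = map ?\<nu> w" for w
    by (induction w) (auto simp: sandwich_def)
  have M: "meets (N (\<phi> u)) (map ?\<nu> (N u))" if u: "u \<in> carrier G" for u
  proof -
    have "reduced (map ?\<nu> (N u))"
      using N_reduced[OF u] by (rule reduced_map) simp_all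
    then have "N (inv\<^bsub>G\<^esub> t \<otimes>\<^bsub>G\<^esub> \<phi> u \<otimes>\<^bsub>G\<^esub> t) = map ?\<nu> (N u)"
      using N_conj_phi[OF th(1) n(1) u] unfolding th(2) sandwich by (simp only: nf_reduced)
    moreover have "conjugate_in G (\<phi> u) (inv\<^bsub>G\<^esub> t \<otimes>\<^bsub>G\<^esub> \<phi> u \<otimes>\<^bsub>G\<^esub> t)"
      unfolding conjugate_in_def using t u conj_back[OF t(1) \<phi>.hom_closed[OF u] HOL.refl] by blast
    ultimately show ?thesis using conjugate_iff t u by (metis G.inv_closed G.m_closed \<phi>.hom_closed)
  qed
  show ?thesis
    using n(1) E M by (auto simp: list.map_id)
qed

end

section \<open>The decision procedure\<close>

lemma computable_list_weaken:
  "computable_list n F \<Longrightarrow> computable_list (Suc (Suc n)) (\<lambda>ys. F (drop 2 ys))"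
  unfolding computable_list_def by (rule computable_weaken)

lemma computable_list_foldr_encoded:
  assumes "computable_list n L" and "computable_list n S"
    and "\<And>k F f. computable k f \<Longrightarrow> computable_list k F \<Longrightarrow> computable_list k (\<lambda>ys. H (f ys) (F ys))"
  shows "computable_list n (\<lambda>xs. foldr H (L xs) (S xs))"
  by (intro computable_list_foldr assms computable_list_decode computable_proj) auto

context free_product_cyclic
begin

lemma computable_list_act:
  assumes "computable n f" and "computable_list n F"
  shows "computable_list n (\<lambda>xs. act (f xs) (F xs))"
proof -
  have *: "act l w = (if w = [] \<or> (head0 w = 0 \<and> \<not> l = 0) \<or> (\<not> head0 w = 0 \<and> l = 0) then l # w
     else if (l + head0 w) mod m = 0 then tl w else (l + head0 w) mod m # tl w)" for l w
    by (auto simp: act_def)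
  show ?thesis unfolding *
    by (intro computable_list_if computable_pred_disj computable_pred_conj computable_pred_not
        computable_pred_list_eq computable_pred_eq computable_list_Cons computable_head0_tl
        computable_mod computable_add computable_const computable_list_const assms)
qed

lemma computable_list_foldr_act:
  assumes "computable_list n F" and "computable_list n S"
  shows "computable_list n (\<lambda>xs. foldr act (F xs) (S xs))"
  using assms computable_list_act by (rule computable_list_foldr_encoded)

lemma computable_list_rot_funpow:
  assumes "computable n N" and "computable_list n F"
  shows "computable_list n (\<lambda>xs. (rot ^^ N xs) (F xs))"
proof -
  have "computable_list 1 (\<lambda>ys. rot (list_decode (ys ! 0)))"
    unfolding rot_def nf_def
    by (intro computable_list_foldr_act computable_list_rotate1 computable_list_decode
        computable_list_const computable_proj) simp
  then show ?thesis using assms by (intro computable_list_funpow)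
qed

lemma computable_list_map_neg:
  assumes "computable_list n F"
  shows "computable_list n (\<lambda>xs. map neg (F xs))"
proof -
  have *: "map neg w = foldr (\<lambda>l v. neg l # v) w []" for w by (induction w) auto
  show ?thesis
    unfolding * neg_def
    by (rule computable_list_foldr_encoded)
      (intro assms computable_list_const computable_list_Cons computable_mod computable_diff
        computable_const | assumption)+
qed

text \<open>The bounds are the codes of the words instead of their lengths: they are larger, and already at
  hand.\<close>

definition meets_test :: "nat list \<Rightarrow> nat list \<Rightarrow> bool" where
  "meets_test u v \<longleftrightarrow>
     (\<exists>i<Suc (list_encode u + list_encode u). (rot ^^ i) u = (rot ^^ list_encode v) v)"

lemma meets_test: "reduced u \<Longrightarrow> reduced v \<Longrightarrow> meets_test u v \<longleftrightarrow> meets u v"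
  unfolding meets_test_def
  using meets_bounded[of u v "list_encode v" "Suc (list_encode u + list_encode u)"]
    length_le_list_encode[of u] length_le_list_encode[of v] by simp

lemma computable_meets_test:
  assumes "computable_list n U" and "computable_list n V"
  shows "computable_pred n (\<lambda>xs. meets_test (U xs) (V xs))"
proof -
  have "computable n (\<lambda>xs. list_encode (U xs))" "computable n (\<lambda>xs. list_encode (V xs))"
    using assms by (simp_all add: computable_list_def)
  then show ?thesis unfolding meets_test_def
    by (intro computable_pred_bex_less computable_pred_list_eq computable_list_rot_funpow
        computable_list_weaken computable_weaken[where f = "\<lambda>xs. list_encode (V xs)"]
        computable_Suc computable_add computable_proj assms) auto
qed

end

context odd_dihedral_artin
begin

lemma word_value_carrier: "X \<subseteq> carrier G \<Longrightarrow> u \<in> lists X \<Longrightarrow> word_value G u \<in> carrier G"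
  by (induction u) (auto simp: word_value_def)

lemma N_E_word_value:
  assumes "X \<subseteq> carrier G" "u \<in> lists X"
  shows "N (word_value G u) = foldr (\<lambda>g. foldr act (N g)) u []"
    and "E (word_value G u) = int (foldr (\<lambda>g. (+) (nat (E g))) u 0) - int (foldr (\<lambda>g. (+) (nat (- E g))) u 0)"
proof -
  have "N (word_value G u) = foldr (\<lambda>g. foldr act (N g)) u [] \<and>
     E (word_value G u) = int (foldr (\<lambda>g. (+) (nat (E g))) u 0) - int (foldr (\<lambda>g. (+) (nat (- E g))) u 0)"
    using assms(2)
  proof (induction u rule: list.induct)
    case (Cons g u)
    then have g: "g \<in> carrier G" and u: "u \<in> lists X" using assms(1) by auto
    have v: "word_value G (g # u) = g \<otimes>\<^bsub>G\<^esub> word_value G u" by (simp add: word_value_def)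
    note wv = word_value_carrier[OF assms(1) u]
    have "N (word_value G (g # u)) = foldr act (N g) (N (word_value G u))"
      unfolding v N_mult[OF g wv] nf_append using nf_reduced[OF N_reduced[OF wv]] by simp
    moreover have "E (word_value G (g # u)) = E g + E (word_value G u)"
      unfolding v by (rule E_mult[OF g wv])
    ultimately show ?case using Cons.IH[OF u] by auto
  qed (simp add: word_value_def)
  then show "N (word_value G u) = foldr (\<lambda>g. foldr act (N g)) u []"
    and "E (word_value G u) = int (foldr (\<lambda>g. (+) (nat (E g))) u 0) - int (foldr (\<lambda>g. (+) (nat (- E g))) u 0)"
    by auto
qed

definition inverting :: "(dgen gword set \<Rightarrow> dgen gword set) \<Rightarrow> bool" where
  "inverting \<phi> \<longleftrightarrow> (\<forall>g\<in>carrier G. E (\<phi> g) = - E g \<and> meets (N (\<phi> g)) (map neg (N g)))"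

text \<open>The first alternative is attained by the identity, the second one by any inverting automorphism;
  by \<open>automorphism_cases\<close> there are no others.\<close>

lemma orbit_iff:
  assumes A: "subgroup A (AutoGroup G)" and g: "g \<in> carrier G" and h: "h \<in> carrier G"
  shows "(\<exists>\<phi>\<in>A. conjugate_in G h (\<phi> g)) \<longleftrightarrow>
    (E h = E g \<and> meets (N h) (N g)) \<or>
    ((\<exists>\<phi>\<in>A. inverting \<phi>) \<and> E h = - E g \<and> meets (N h) (map neg (N g)))"
proof -
  have aut: "\<phi> \<in> auto G" if "\<phi> \<in> A" for \<phi>
    using subgroup.subset[OF A] that by (auto simp: AutoGroup_def)
  have closed: "\<phi> g \<in> carrier G" if "\<phi> \<in> A" for \<phi>
    using aut[OF that] g by (auto simp: auto_def hom_def)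
  have conj: "conjugate_in G h (\<phi> g) \<longleftrightarrow> E h = E (\<phi> g) \<and> meets (N h) (N (\<phi> g))" if "\<phi> \<in> A" for \<phi>
    by (rule conjugate_iff[OF h closed[OF that]])
  have idA: "(\<lambda>x\<in>carrier G. x) \<in> A"
    using subgroup.one_closed[OF A] by (simp add: AutoGroup_def BijGroup_def)
  have id: "\<exists>\<phi>\<in>A. conjugate_in G h (\<phi> g)" if "E h = E g \<and> meets (N h) (N g)"
  proof (rule bexI[OF _ idA])
    show "conjugate_in G h ((\<lambda>x\<in>carrier G. x) g)" unfolding conj[OF idA] using that g by simp
  qed
  show ?thesis
  proof
    assume "\<exists>\<phi>\<in>A. conjugate_in G h (\<phi> g)"
    then obtain \<phi> where \<phi>: "\<phi> \<in> A" "E h = E (\<phi> g)" "meets (N h) (N (\<phi> g))" using conj by blast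
    interpret artin_automorphism m k \<phi> by unfold_locales (rule aut[OF \<phi>(1)])
    show "(E h = E g \<and> meets (N h) (N g)) \<or>
        ((\<exists>\<phi>\<in>A. inverting \<phi>) \<and> E h = - E g \<and> meets (N h) (map neg (N g)))"
    proof (rule disjE[OF automorphism_cases])
      assume "\<forall>u\<in>carrier G. E (\<phi> u) = E u \<and> meets (N (\<phi> u)) (N u)"
      then show ?thesis using \<phi>(2,3) g meets_trans[of "N h" "N (\<phi> g)" "N g"] by simp
    next
      assume inv: "\<forall>u\<in>carrier G. E (\<phi> u) = - E u \<and> meets (N (\<phi> u)) (map neg (N u))"
      then have "\<exists>\<phi>\<in>A. inverting \<phi>" using \<phi>(1) by (auto simp: inverting_def)
      then show ?thesis
        using inv \<phi>(2,3) g meets_trans[of "N h" "N (\<phi> g)" "map neg (N g)"] by simp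
    qed
  next
    assume "(E h = E g \<and> meets (N h) (N g)) \<or>
        ((\<exists>\<phi>\<in>A. inverting \<phi>) \<and> E h = - E g \<and> meets (N h) (map neg (N g)))"
    then show "\<exists>\<phi>\<in>A. conjugate_in G h (\<phi> g)"
    proof
      assume "(\<exists>\<phi>\<in>A. inverting \<phi>) \<and> E h = - E g \<and> meets (N h) (map neg (N g))"
      then obtain \<phi> where \<phi>: "\<phi> \<in> A" "inverting \<phi>" "E h = - E g" "meets (N h) (map neg (N g))"
        by blast
      then have "E (\<phi> g) = - E g" "meets (map neg (N g)) (N (\<phi> g))"
        using g by (auto simp: inverting_def intro: meets_sym)
      then have "conjugate_in G h (\<phi> g)"
        unfolding conj[OF \<phi>(1)] using \<phi>(3,4) meets_trans by auto
      then show ?thesis using \<phi>(1) by blast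
    qed (rule id)
  qed
qed

text \<open>Both alternatives of \<open>orbit_iff\<close> are tests on \<open>N\<close> and \<open>E\<close> of the two elements, which a fold over
  the input words computes from tables for the letters.\<close>

theorem orbit_decidable_subgroup:
  assumes "finite X" "X \<subseteq> carrier G" and A: "subgroup A (AutoGroup G)"
  shows "orbit_decidable G X A"
  unfolding orbit_decidable_def decidable_word_pairs_def
proof (intro allI impI)
  fix c :: "dgen gword set \<Rightarrow> nat" assume inj: "inj_on c X"
  \<comment> \<open>a fixed truth value, built into the program\<close>
  define B where "B \<longleftrightarrow> (\<exists>\<phi>\<in>A. inverting \<phi>)"
  define tab where "tab f i = (if i \<in> c ` X then f (inv_into X c i) else 0)"
    for f :: "dgen gword set \<Rightarrow> nat" and i
  have tab: "tab f (c x) = f x" if "x \<in> X" for f x using that inj by (simp add: tab_def)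
  have "{i. tab f i \<noteq> 0} \<subseteq> c ` X" for f by (auto simp: tab_def split: if_splits)
  then have "finite {i. tab f i \<noteq> 0}" for f using assms(1) by (meson finite_imageI finite_subset)
  then have tab_computable: "computable n (\<lambda>xs. tab f (F xs))" if "computable n F" for f n F
    using that by (rule computable_finite_table)
  define tN where "tN = tab (\<lambda>g. list_encode (N g))"
  \<comment> \<open>integers are handled as differences of natural numbers\<close>
  define tP where "tP = tab (\<lambda>g. nat (E g))"
  define tM where "tM = tab (\<lambda>g. nat (- E g))"
  define W where "W w = foldr (\<lambda>i. foldr act (list_decode (tN i))) w []" for w
  define P where "P w = foldr (\<lambda>i. (+) (tP i)) w 0" for w
  define M where "M w = foldr (\<lambda>i. (+) (tM i)) w 0" for w
  have cW: "computable_list n (\<lambda>xs. W (F xs))" if "computable_list n F" for n F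
    unfolding W_def tN_def
    by (rule computable_list_foldr_encoded[OF that computable_list_const])
      (intro computable_list_foldr_act computable_list_decode tab_computable | assumption)+
  have cP: "computable n (\<lambda>xs. P (F xs))" and cM: "computable n (\<lambda>xs. M (F xs))"
    if "computable_list n F" for n F
    unfolding P_def M_def tP_def tM_def
    by (rule computable_foldr[OF that computable_const];
        intro computable_add tab_computable computable_proj; simp)+
  have W: "W (map c u) = N (word_value G u)"
    and PM: "int (P (map c u)) - int (M (map c u)) = E (word_value G u)" if u: "u \<in> lists X" for u
  proof -
    have fold: "foldr (\<lambda>i. H (tab f i)) (map c u) s = foldr (\<lambda>g. H (f g)) u s"
      for f and H :: "nat \<Rightarrow> 's \<Rightarrow> 's" and s
      using u by (induction u rule: list.induct) (auto simp: tab)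
    show "W (map c u) = N (word_value G u)"
      unfolding W_def tN_def N_E_word_value(1)[OF assms(2) u]
      using fold[of "\<lambda>n. foldr act (list_decode n)"] by simp
    show "int (P (map c u)) - int (M (map c u)) = E (word_value G u)"
      unfolding P_def M_def tP_def tM_def N_E_word_value(2)[OF assms(2) u]
      using fold[of "(+)"] by simp
  qed
  define D where "D xs \<longleftrightarrow>
     (let u = list_decode (xs ! 0); v = list_decode (xs ! 1) in
       (P v + M u = P u + M v \<and> meets_test (W v) (W u)) \<or>
       (B \<and> P v + P u = M v + M u \<and> meets_test (W v) (map neg (W u))))" for xs
  have "computable_pred 2 D"
    unfolding D_def[abs_def] Let_def
    by (intro computable_pred_disj computable_pred_conj computable_pred_const computable_pred_eq
        computable_add cP cM computable_meets_test cW computable_list_map_neg computable_list_decode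
        computable_proj) simp_all
  then obtain p where p: "\<And>xs. length xs = 2 \<Longrightarrow> evaluates p xs (if D xs then 1 else 0)"
    by (auto simp: computable_pred_def computable_def)
  have D: "D [list_encode (map c u), list_encode (map c v)] \<longleftrightarrow> (u, v) \<in> orbit_problem G X A"
    if u: "u \<in> lists X" and v: "v \<in> lists X" for u v
  proof -
    let ?g = "word_value G u" and ?h = "word_value G v"
    have g: "?g \<in> carrier G" and h: "?h \<in> carrier G"
      using word_value_carrier[OF assms(2)] u v by auto
    have neg: "reduced (map neg (N ?g))" using N_reduced[OF g] by (rule reduced_map) simp_all
    have "P (map c v) + M (map c u) = P (map c u) + M (map c v) \<longleftrightarrow> E ?h = E ?g"
      and "P (map c v) + P (map c u) = M (map c v) + M (map c u) \<longleftrightarrow> E ?h = - E ?g"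
      using PM[OF u] PM[OF v] by linarith+
    then have "D [list_encode (map c u), list_encode (map c v)] \<longleftrightarrow>
        (E ?h = E ?g \<and> meets (N ?h) (N ?g)) \<or> (B \<and> E ?h = - E ?g \<and> meets (N ?h) (map neg (N ?g)))"
      using N_reduced[OF g] N_reduced[OF h] neg W[OF u] W[OF v] by (simp add: D_def meets_test)
    also have "\<dots> \<longleftrightarrow> (\<exists>\<phi>\<in>A. conjugate_in G ?h (\<phi> ?g))"
      unfolding B_def by (rule orbit_iff[OF A g h, symmetric])
    finally show ?thesis using u v by (simp add: orbit_problem_def)
  qed
  show "\<exists>p. \<forall>u\<in>lists X. \<forall>v\<in>lists X.
      evaluates p [list_encode (map c u), list_encode (map c v)]
        (if (u, v) \<in> orbit_problem G X A then 1 else 0)"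
  proof (intro exI ballI)
    fix u v assume "u \<in> lists X" "v \<in> lists X"
    from D[OF this] p[of "[list_encode (map c u), list_encode (map c v)]"]
    show "evaluates p [list_encode (map c u), list_encode (map c v)]
        (if (u, v) \<in> orbit_problem G X A then 1 else 0)" by simp
  qed
qed

end

theorem theorem5p1:
  fixes m :: nat
    and X :: "dgen gword set set"
    and A :: "(dgen gword set \<Rightarrow> dgen gword set) set"
  assumes "m \<ge> 3" and "odd m"
    and "finite X" and "inverse_closed_generating_set (dihedral_artin m) X"
    and "finitely_generated_subgroup A (AutoGroup (dihedral_artin m))"
  shows "orbit_decidable (dihedral_artin m) X A"
proof -
  obtain k where k: "m = 2 * k + 1" using assms(2) by (rule oddE)
  interpret odd_dihedral_artin m k
    using assms(1) k by unfold_locales simp_all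
  show ?thesis
    using assms(3,4,5)
    by (intro orbit_decidable_subgroup)
      (auto simp: inverse_closed_generating_set_def finitely_generated_subgroup_def)
qed

end
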